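(* For every regular unstable RB there exist constants $c>0$ and $N_0$ such that for every $N\ge N_0$ (with $\alpha N$ integer), every policy $\pi$ for the $N$-armed problem whose long-run average reward is well defined, and every initial state vector $\mathbf S_0$, $$R^{\mathrm{rel}}-R(\pi,\mathbf S_0)\ge\frac{c}{\sqrt N}.$$
   Context: Single-armed MDP $(\mathbb S,\{0,1\},P,r)$, finite $\mathbb S$, budget $\alpha\in(0,1)$. $N$-armed problem: $N$ arms transition independently by $P$ given states and actions; at each $t$ a policy chooses $A_t(i)\in\{0,1\}$ with $\sum_iA_t(i)=\alpha N$. $S_t(i)$ arm states, $X_t([N])=(X_t([N],s))_s$ with $X_t([N],s)=\frac1N\#\{i:S_t(i)=s\}$. $R(\pi,\mathbf S_0)=\lim_{T\to\infty}\frac1T\sum_{t<T}\frac1N\sum_i\mathbb E[r(S_t(i),A_t(i))]$. LP relaxation: maximize $\sum r(s,a)y(s,a)$ over $y\ge0$ s.t. $\sum_sy(s,1)=\alpha$, $\sum_{s',a}y(s',a)P(s',a,s)=\sum_ay(s,a)$ for all $s$, $\sum y=1$; $R^{\mathrm{rel}}$ its optimal value, $y^*$ an optimal solution. $\bar\pi^*(a|s)=y^*(s,a)/(y^*(s,0)+y^*(s,1))$ if denominator $>0$, else $1/2$; $P_{\bar\pi^*}(s,s')=\sum_a\bar\pi^*(a|s)P(s,a,s')$; $\mu^*(s)=y^*(s,0)+y^*(s,1)$. Assumption 1: $1$ is a simple eigenvalue of $P_{\bar\pi^*}$, all other eigenvalues have modulus $<1$. Assumption 2: unique $\tilde s$ with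 $y^*(\tilde s,0),y^*(\tilde s,1)>0$. $\Phi=P_{\bar\pi^*}-\mathbf 1^\top\mu^*-(c-\alpha\mathbf 1)^\top(P_1(\tilde s)-P_0(\tilde s))$, $c=(\bar\pi^*(1|s))_s$, $P_a(\tilde s)=(P(\tilde s,a,s))_s$, $\mathbf 1$ all-ones row vector. $S^+=\{s:y^*(s,1)>0,y^*(s,0)=0\}$, $S^-=\{s:y^*(s,1)=0,y^*(s,0)>0\}$, $S^\emptyset=\{s:y^*(s,1)=y^*(s,0)=0\}$. Randomized rounding of $c\ge0$: $\lceil c\rceil$ w.p. $c-\lfloor c\rfloor$, else $\lfloor c\rfloor$. Optimal Local Control (OLC) applied to all $N$ arms, with $z(s)$ arms in state $s$, is defined when $\sum_{s\neq\tilde s}\bar\pi^*(1|s)z(s)\le\alpha N-|S^\emptyset|-1$ and $\sum_{s\neq\tilde s}\bar\pi^*(0|s)z(s)\le(1-\alpha)N-|S^\emptyset|-1$: let $B$ be a randomized rounding of $\alpha N$; activate all arms in $S^+$, none in $S^-$, a randomized rounding of $z(s)/2$ arms in each $s\in S^\emptyset$, and arms in $\tilde s$ so that exactly $B$ are active. Regular unstable RB: an instance satisfying Assumptions 1 and 2 and: (a) the LP relaxation has a unique optimal solution $y^*$ and $y^*(s,1)+y^*(s,0)>0$ for all $s$; (b) $\Phi$ has at least one eigenvalue of modulus $>1$ and no eigenvalue of modulus exactly $1$; (c) there are constants $\eta',K_{\mathrm{noise}}>0$ (with $\eta'$ small enough that OLC is defined whenever $\|X_t([N])-\mu^*\|_1\le\eta'$)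 such that for all sufficiently large $N$, every $t$, and every $\xi\in\mathbb R^{\mathbb S}$ with $\|\xi\|_2=1$ and $\mu^*\xi^\top=0$: if $\|X_t([N])-\mu^*\|_1\le\eta'$ and $\mathbf A_t$ is chosen by OLC applied to all $N$ arms, then $\mathbb E\big[|(X_{t+1}([N])-\mu^*-(X_t([N])-\mu^* )\Phi)\xi^\top|\,\big|\,X_t,\mathbf A_t\big]\ge K_{\mathrm{noise}}/\sqrt N$. *)

theory Defs
  imports "HOL-Probability.Probability" "HOL-Computational_Algebra.Polynomial"
begin

text \<open>States: a finite type 's. Actions: bool (True = 1 = active).
 Transition kernel P s a is a pmf on next states; P(s,a,s') = pmf (P s a) s'.
 Reward r s a. Budget alpha.\<close>

definition lp_feasible :: "('s::finite \<Rightarrow> bool \<Rightarrow> 's pmf) \<Rightarrow> real \<Rightarrow> ('s \<Rightarrow> bool \<Rightarrow> real) \<Rightarrow> bool" where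
  "lp_feasible P \<alpha> y \<longleftrightarrow>
     (\<forall>s a. y s a \<ge> 0) \<and>
     (\<Sum>s\<in>UNIV. y s True) = \<alpha> \<and>
     (\<forall>s. (\<Sum>s'\<in>UNIV. \<Sum>a\<in>UNIV. y s' a * pmf (P s' a) s) = (\<Sum>a\<in>UNIV. y s a)) \<and>
     (\<Sum>s\<in>UNIV. \<Sum>a\<in>UNIV. y s a) = 1"

definition lp_obj :: "('s::finite \<Rightarrow> bool \<Rightarrow> real) \<Rightarrow> ('s \<Rightarrow> bool \<Rightarrow> real) \<Rightarrow> real" where
  "lp_obj r y = (\<Sum>s\<in>UNIV. \<Sum>a\<in>UNIV. r s a * y s a)"

definition lp_optimal :: "('s::finite \<Rightarrow> bool \<Rightarrow> 's pmf) \<Rightarrow> ('s \<Rightarrow> bool \<Rightarrow> real) \<Rightarrow> real \<Rightarrow> ('s \<Rightarrow> bool \<Rightarrow> real) \<Rightarrow> bool" where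
  "lp_optimal P r \<alpha> y \<longleftrightarrow> lp_feasible P \<alpha> y \<and> (\<forall>y'. lp_feasible P \<alpha> y' \<longrightarrow> lp_obj r y' \<le> lp_obj r y)"

definition R_rel :: "('s::finite \<Rightarrow> bool \<Rightarrow> 's pmf) \<Rightarrow> ('s \<Rightarrow> bool \<Rightarrow> real) \<Rightarrow> real \<Rightarrow> real" where
  "R_rel P r \<alpha> = (SUP y\<in>{y. lp_feasible P \<alpha> y}. lp_obj r y)"

text \<open>The (unique, under the regularity assumption) optimal solution y*.\<close>
definition ystar :: "('s::finite \<Rightarrow> bool \<Rightarrow> 's pmf) \<Rightarrow> ('s \<Rightarrow> bool \<Rightarrow> real) \<Rightarrow> real \<Rightarrow> ('s \<Rightarrow> bool \<Rightarrow> real)" where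
  "ystar P r \<alpha> = (THE y. lp_optimal P r \<alpha> y)"

definition mu_of :: "('s \<Rightarrow> bool \<Rightarrow> real) \<Rightarrow> 's \<Rightarrow> real" where
  "mu_of y s = y s False + y s True"

definition pibar :: "('s \<Rightarrow> bool \<Rightarrow> real) \<Rightarrow> bool \<Rightarrow> 's \<Rightarrow> real" where
  "pibar y a s = (if mu_of y s > 0 then y s a / mu_of y s else 1/2)"

definition P_pibar :: "('s::finite \<Rightarrow> bool \<Rightarrow> 's pmf) \<Rightarrow> ('s \<Rightarrow> bool \<Rightarrow> real) \<Rightarrow> 's \<Rightarrow> 's \<Rightarrow> real" where
  "P_pibar P y s s' = (\<Sum>a\<in>UNIV. pibar y a s * pmf (P s a) s')"

text \<open>Phi = P_pibar - 1^T mu* - (c - alpha 1)^T (P_1(st) - P_0(st)), row-vector convention.\<close>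
definition Phi_mat :: "('s::finite \<Rightarrow> bool \<Rightarrow> 's pmf) \<Rightarrow> real \<Rightarrow> ('s \<Rightarrow> bool \<Rightarrow> real) \<Rightarrow> 's \<Rightarrow> 's \<Rightarrow> 's \<Rightarrow> real" where
  "Phi_mat P \<alpha> y st s s' = P_pibar P y s s' - mu_of y s'
      - (pibar y True s - \<alpha>) * (pmf (P st True) s' - pmf (P st False) s')"

definition Splus :: "('s \<Rightarrow> bool \<Rightarrow> real) \<Rightarrow> 's \<Rightarrow> bool" where
  "Splus y s \<longleftrightarrow> y s True > 0 \<and> y s False = 0"
definition Sminus :: "('s \<Rightarrow> bool \<Rightarrow> real) \<Rightarrow> 's \<Rightarrow> bool" where
  "Sminus y s \<longleftrightarrow> y s True = 0 \<and> y s False > 0"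
definition Sempty :: "('s \<Rightarrow> bool \<Rightarrow> real) \<Rightarrow> 's \<Rightarrow> bool" where
  "Sempty y s \<longleftrightarrow> y s True = 0 \<and> y s False = 0"

definition charpoly :: "('s::finite \<Rightarrow> 's \<Rightarrow> real) \<Rightarrow> complex poly" where
  "charpoly M = det (\<chi> i j. (if i = j then [:0, 1:] else 0) - [: complex_of_real (M i j) :]
                       :: complex poly ^'s ^'s)"

definition eigenvalue :: "('s::finite \<Rightarrow> 's \<Rightarrow> real) \<Rightarrow> complex \<Rightarrow> bool" where
  "eigenvalue M z \<longleftrightarrow> poly (charpoly M) z = 0"

definition alg_mult :: "('s::finite \<Rightarrow> 's \<Rightarrow> real) \<Rightarrow> complex \<Rightarrow> nat" where
  "alg_mult M z = order z (charpoly M)"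

fun next_states :: "('s \<Rightarrow> bool \<Rightarrow> 's pmf) \<Rightarrow> 's list \<Rightarrow> bool list \<Rightarrow> 's list pmf" where
  "next_states P (s # ss) (a # as) =
     bind_pmf (P s a) (\<lambda>s'. bind_pmf (next_states P ss as) (\<lambda>ss'. return_pmf (s' # ss')))"
| "next_states P _ _ = return_pmf []"

text \<open>A (history-dependent, randomized) policy maps the history of past
 (state vector, action vector) pairs and the current state vector to a
 distribution over action vectors.\<close>
type_synonym 's policy = "('s list \<times> bool list) list \<Rightarrow> 's list \<Rightarrow> bool list pmf"

definition admissible_policy :: "nat \<Rightarrow> real \<Rightarrow> 's policy \<Rightarrow> bool" where
  "admissible_policy N \<alpha> pol \<longleftrightarrow>
     (\<forall>h s a. length s = N \<longrightarrow> a \<in> set_pmf (pol h s) \<longrightarrow>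
        length a = N \<and> real (card {i. i < N \<and> a ! i}) = \<alpha> * real N)"

primrec hist_pmf :: "('s \<Rightarrow> bool \<Rightarrow> 's pmf) \<Rightarrow> 's policy \<Rightarrow> 's list \<Rightarrow> nat
                      \<Rightarrow> (('s list \<times> bool list) list \<times> 's list) pmf" where
  "hist_pmf P pol S0 0 = return_pmf ([], S0)"
| "hist_pmf P pol S0 (Suc t) =
     bind_pmf (hist_pmf P pol S0 t) (\<lambda>(h, s).
       bind_pmf (pol h s) (\<lambda>a.
         map_pmf (\<lambda>s'. (h @ [(s, a)], s')) (next_states P s a)))"

definition exp_reward :: "('s \<Rightarrow> bool \<Rightarrow> 's pmf) \<Rightarrow> ('s \<Rightarrow> bool \<Rightarrow> real) \<Rightarrow> 's policy \<Rightarrow> 's list \<Rightarrow> nat \<Rightarrow> real" where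
  "exp_reward P r pol S0 t =
     measure_pmf.expectation (hist_pmf P pol S0 t) (\<lambda>(h, s).
       measure_pmf.expectation (pol h s) (\<lambda>a.
         (\<Sum>i<length s. r (s ! i) (a ! i)) / real (length s)))"

definition avg_reward_seq :: "('s \<Rightarrow> bool \<Rightarrow> 's pmf) \<Rightarrow> ('s \<Rightarrow> bool \<Rightarrow> real) \<Rightarrow> 's policy \<Rightarrow> 's list \<Rightarrow> nat \<Rightarrow> real" where
  "avg_reward_seq P r pol S0 T = (\<Sum>t<T. exp_reward P r pol S0 t) / real T"

definition long_run_reward :: "('s \<Rightarrow> bool \<Rightarrow> 's pmf) \<Rightarrow> ('s \<Rightarrow> bool \<Rightarrow> real) \<Rightarrow> 's policy \<Rightarrow> 's list \<Rightarrow> real" where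
  "long_run_reward P r pol S0 = lim (avg_reward_seq P r pol S0)"

definition reward_well_defined :: "('s \<Rightarrow> bool \<Rightarrow> 's pmf) \<Rightarrow> ('s \<Rightarrow> bool \<Rightarrow> real) \<Rightarrow> 's policy \<Rightarrow> 's list \<Rightarrow> bool" where
  "reward_well_defined P r pol S0 \<longleftrightarrow> convergent (avg_reward_seq P r pol S0)"

definition count_st :: "'s list \<Rightarrow> 's \<Rightarrow> nat" where
  "count_st ss s = card {i. i < length ss \<and> ss ! i = s}"

definition X_of :: "'s list \<Rightarrow> 's \<Rightarrow> real" where
  "X_of ss s = real (count_st ss s) / real (length ss)"

definition rround :: "real \<Rightarrow> int pmf" where
  "rround x = map_pmf (\<lambda>b. if b then \<lceil>x\<rceil> else \<lfloor>x\<rfloor>) (bernoulli_pmf (x - of_int \<lfloor>x\<rfloor>))"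

text \<open>Given budget B and (for S-empty states) numbers k s, OLC activates all arms in S+,
 none in S-, the first k s arms (by index) in each S-empty state s, and the first
 arms in st so that exactly B are active.\<close>
definition olc_actions :: "('s::finite \<Rightarrow> bool \<Rightarrow> real) \<Rightarrow> 's \<Rightarrow> 's list \<Rightarrow> int \<Rightarrow> ('s \<Rightarrow> int) \<Rightarrow> bool list" where
  "olc_actions y st ss B k = map (\<lambda>i.
      if Splus y (ss ! i) then True
      else if Sminus y (ss ! i) then False
      else if Sempty y (ss ! i) then int (card {j. j < i \<and> ss ! j = ss ! i}) < k (ss ! i)
      else int (card {j. j < i \<and> ss ! j = st}) <
             B - int (card {j. j < length ss \<and> Splus y (ss ! j)}) - (\<Sum>s\<in>{s. Sempty y s}. k s))
    [0..<length ss]"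

definition olc_pmf :: "real \<Rightarrow> ('s::finite \<Rightarrow> bool \<Rightarrow> real) \<Rightarrow> 's \<Rightarrow> 's list \<Rightarrow> bool list pmf" where
  "olc_pmf \<alpha> y st ss =
     bind_pmf (rround (\<alpha> * real (length ss))) (\<lambda>B.
       map_pmf (\<lambda>k. olc_actions y st ss B k)
         (Pi_pmf {s. Sempty y s} 0 (\<lambda>s. rround (real (count_st ss s) / 2))))"

definition olc_defined :: "real \<Rightarrow> ('s::finite \<Rightarrow> bool \<Rightarrow> real) \<Rightarrow> 's \<Rightarrow> 's list \<Rightarrow> bool" where
  "olc_defined \<alpha> y st ss \<longleftrightarrow>
     (\<Sum>s\<in>UNIV - {st}. pibar y True s * real (count_st ss s))
        \<le> \<alpha> * real (length ss) - real (card {s. Sempty y s}) - 1 \<and>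
     (\<Sum>s\<in>UNIV - {st}. pibar y False s * real (count_st ss s))
        \<le> (1 - \<alpha>) * real (length ss) - real (card {s. Sempty y s}) - 1"

definition regular_unstable_RB :: "('s::finite \<Rightarrow> bool \<Rightarrow> 's pmf) \<Rightarrow> ('s \<Rightarrow> bool \<Rightarrow> real) \<Rightarrow> real \<Rightarrow> bool" where
  "regular_unstable_RB P r \<alpha> \<longleftrightarrow>
    (let y = ystar P r \<alpha>; \<mu> = mu_of y in
     \<comment> \<open>(a) unique optimal solution, full support\<close>
     (\<exists>!y'. lp_optimal P r \<alpha> y') \<and> (\<forall>s. \<mu> s > 0) \<and>
     \<comment> \<open>Assumption 1\<close>
     alg_mult (P_pibar P y) 1 = 1 \<and>
     (\<forall>z. eigenvalue (P_pibar P y) z \<and> z \<noteq> 1 \<longrightarrow> cmod z < 1) \<and>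
     \<comment> \<open>Assumption 2\<close>
     (\<exists>!st. y st False > 0 \<and> y st True > 0) \<and>
     (let st = (THE st. y st False > 0 \<and> y st True > 0); \<Phi> = Phi_mat P \<alpha> y st in
      \<comment> \<open>(b)\<close>
      (\<exists>z. eigenvalue \<Phi> z \<and> cmod z > 1) \<and>
      (\<forall>z. eigenvalue \<Phi> z \<longrightarrow> cmod z \<noteq> 1) \<and>
      \<comment> \<open>(c)\<close>
      (\<exists>\<eta>' K N1. \<eta>' > 0 \<and> K > 0 \<and>
        (\<forall>N \<ge> N1. \<forall>ss. length ss = N \<longrightarrow>
           (\<Sum>s\<in>UNIV. \<bar>X_of ss s - \<mu> s\<bar>) \<le> \<eta>' \<longrightarrow>
             olc_defined \<alpha> y st ss \<and>
             (\<forall>a \<in> set_pmf (olc_pmf \<alpha> y st ss). \<forall>\<xi>::'s \<Rightarrow> real.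
                sqrt (\<Sum>s\<in>UNIV. (\<xi> s)\<^sup>2) = 1 \<longrightarrow> (\<Sum>s\<in>UNIV. \<mu> s * \<xi> s) = 0 \<longrightarrow>
                measure_pmf.expectation (next_states P ss a) (\<lambda>ss'.
                  \<bar>\<Sum>s\<in>UNIV. (X_of ss' s - \<mu> s
                      - (\<Sum>s0\<in>UNIV. (X_of ss s0 - \<mu> s0) * \<Phi> s0 s)) * \<xi> s\<bar>)
                \<ge> K / sqrt (real N))))))"

end

theory Submission
  imports Defs "HOL-Computational_Algebra.Fundamental_Theorem_Algebra"
begin

text \<open>Call the mass on pairs (s, a) with y*(s, a) = 0 wrong. Since the optimum is unique and the
  feasible set is a polytope, the optimality gap of a feasible point is at least a constant times
  its wrong mass, so it suffices to bound the long-run wrong mass W of any policy below by a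
  multiple of 1/sqrt N. Up to an error of order W, the conditional mean of X - mu* evolves by the
  matrix Phi. For an eigenvector w with eigenvalue l, |l| > 1, the coordinate z = (X - mu*) w
  expands in mean, and as it is bounded this forces E|z| = O(W) on time average. As Phi has no
  eigenvalue of modulus one, the remaining coordinates can also be controlled, giving
  E|X - mu*| = O(W + 1/sqrt N); so if W is small, X is mostly close to mu*. There the noise
  hypothesis applies to an action vector differing from OLC in O(NW) arms, hence
  E|z'| + |l| E|z| is at least of order 1/sqrt N - O(W). Comparing the two estimates bounds W below.\<close>

section \<open>Expectations over next states\<close>

text \<open>A policy may depend on the whole history, so there is no stationary law to work with.
  All estimates are therefore summed over t < T with constants independent of N, T and the policy;
  each telescoping leaves one bounded boundary term, the \<open>1\<close> beside the sums, which
  vanishes after division by T. The comparison rests on an asymmetry. The bound on E|z| for a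
  general coordinate carries a noise term T / sqrt N, but along an expanding eigenvector it is
  enough to bound |E z'| by E|z'|, and the noise averages out. The other estimate keeps exactly this
  noise. Three obstacles shape the rest. The noise hypothesis speaks of OLC only, while a policy
  need not follow it; the comparison works because the expected deviation depends on the actions
  only through the multiset of state-action pairs. Phi may fail to be diagonalizable. Its unstable
  eigenvectors may be complex, while the hypothesis takes real directions.\<close>

abbreviation "expect \<equiv> measure_pmf.expectation"

lemma expect_mono:
  fixes f g :: "'a \<Rightarrow> real"
  assumes "finite (set_pmf p)" "\<And>x. x \<in> set_pmf p \<Longrightarrow> f x \<le> g x"
  shows "expect p f \<le> expect p g"
  using assms
  by (intro integral_mono_AE) (auto simp: AE_measure_pmf_iff integrable_measure_pmf_finite)

lemma expect_cong:
  fixes f g :: "'a \<Rightarrow> 'b::{banach, second_countable_topology}"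
  assumes "\<And>x. x \<in> set_pmf p \<Longrightarrow> f x = g x"
  shows "expect p f = expect p g"
  using assms by (intro integral_cong_AE) (auto simp: AE_measure_pmf_iff)

lemma expect_bind:
  fixes h :: "'b \<Rightarrow> 'c::{banach, second_countable_topology}"
  assumes "finite (set_pmf p)" "\<And>x. x \<in> set_pmf p \<Longrightarrow> finite (set_pmf (f x))"
  shows "expect (bind_pmf p f) h = expect p (\<lambda>x. expect (f x) h)"
  by (subst pmf_expectation_bind[where A = "set_pmf p"])
    (use assms in \<open>auto simp: integral_measure_pmf[OF assms(1)]\<close>)

lemma expect_bounds:
  fixes f :: "'a \<Rightarrow> real"
  assumes "finite (set_pmf p)" "\<And>x. x \<in> set_pmf p \<Longrightarrow> a \<le> f x \<and> f x \<le> b"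
  shows "a \<le> expect p f \<and> expect p f \<le> b"
proof -
  have "expect p (\<lambda>_. a) \<le> expect p f" "expect p f \<le> expect p (\<lambda>_. b)"
    by (rule expect_mono; use assms in blast)+
  then show ?thesis by simp
qed

lemma next_states_support:
  assumes "length ss = length as"
  shows "set_pmf (next_states P ss as) \<subseteq> {xs. length xs = length ss}"
  using assms by (induction ss as rule: list_induct2) auto

lemma next_states_finite: 
  fixes P :: "'s::finite \<Rightarrow> bool \<Rightarrow> 's pmf"
  assumes "length ss = length as"
  shows "finite (set_pmf (next_states P ss as))"
proof (rule finite_subset[OF next_states_support[OF assms]])
  show "finite {xs :: 's list. length xs = length ss}"
    using finite_lists_length_eq[of "UNIV :: 's set"] by simp
qed

lemma expect_next_states_Cons:
  fixes P :: "'s::finite \<Rightarrow> bool \<Rightarrow> 's pmf" and h :: "'s list \<Rightarrow> 'c::{banach, second_countable_topology}"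
  assumes "length ss = length as"
  shows "expect (next_states P (s # ss) (a # as)) h
       = expect (P s a) (\<lambda>x. expect (next_states P ss as) (\<lambda>xs. h (x # xs)))"
  using next_states_finite[OF assms, of P]
  by (simp add: map_pmf_def[symmetric] expect_bind)

lemma expect_next_states_sum_list:
  fixes P :: "'s::finite \<Rightarrow> bool \<Rightarrow> 's pmf" and f :: "'s \<Rightarrow> real"
  assumes "length ss = length as"
  shows "expect (next_states P ss as) (\<lambda>xs. sum_list (map f xs))
       = (\<Sum>(s, a)\<leftarrow>zip ss as. expect (P s a) f)"
  using assms
proof (induction ss as rule: list_induct2)
  case (Cons s ss a as)
  then show ?case
    by (subst expect_next_states_Cons)
      (auto simp: integrable_measure_pmf_finite next_states_finite)
qed simp

text \<open>Independence makes the cross term vanish, so variances add along the list, and each arm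
  contributes at most 1 because \<open>f\<close> takes values in the unit interval.\<close>

lemma expect_next_states_variance:
  fixes P :: "'s::finite \<Rightarrow> bool \<Rightarrow> 's pmf" and f :: "'s \<Rightarrow> real"
  assumes "length ss = length as" and f: "\<And>x. 0 \<le> f x \<and> f x \<le> 1"
  shows "expect (next_states P ss as)
      (\<lambda>xs. (sum_list (map f xs) - (\<Sum>(s, a)\<leftarrow>zip ss as. expect (P s a) f))\<^sup>2) \<le> real (length ss)"
  using assms(1)
proof (induction ss as rule: list_induct2)
  case (Cons s ss a as)
  define n where "n = next_states P ss as"
  define m1 where "m1 = expect (P s a) f"
  define m where "m = (\<Sum>(s, a)\<leftarrow>zip ss as. expect (P s a) f)"
  have fin: "finite (set_pmf n)" using next_states_finite[OF Cons.hyps] by (simp add: n_def)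
  have int: "integrable (measure_pmf n) g" for g :: "'s list \<Rightarrow> real"
    using fin by (rule integrable_measure_pmf_finite)
  have int': "integrable (measure_pmf (P s a)) g" for g :: "'s \<Rightarrow> real"
    by (rule integrable_measure_pmf_finite) simp
  have m0: "expect n (\<lambda>xs. sum_list (map f xs) - m) = 0"
    unfolding n_def m_def using expect_next_states_sum_list[OF Cons.hyps, of P f] int
    by (simp add: n_def)
  define V where "V = expect n (\<lambda>xs. (sum_list (map f xs) - m)\<^sup>2)"
  have m1: "0 \<le> m1 \<and> m1 \<le> 1" unfolding m1_def using f by (intro expect_bounds) auto
  have inner: "expect n (\<lambda>xs. (f x + sum_list (map f xs) - (m1 + m))\<^sup>2) = (f x - m1)\<^sup>2 + V" for x
  proof -
    have "expect n (\<lambda>xs. (f x + sum_list (map f xs) - (m1 + m))\<^sup>2)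
        = expect n (\<lambda>xs. (f x - m1)\<^sup>2 + (2 * (f x - m1) * (sum_list (map f xs) - m)
            + (sum_list (map f xs) - m)\<^sup>2))"
      by (intro expect_cong) (simp add: power2_eq_square algebra_simps)
    also have "\<dots> = (f x - m1)\<^sup>2 + (2 * (f x - m1) * expect n (\<lambda>xs. sum_list (map f xs) - m) + V)"
      unfolding V_def by (subst Bochner_Integration.integral_add; (rule int)?)+ simp
    finally show ?thesis by (simp add: m0)
  qed
  have sq: "(f x - m1)\<^sup>2 \<le> 1" for x
    using f[of x] m1 by (simp add: abs_square_le_1 abs_le_iff)
  have "expect (next_states P (s # ss) (a # as))
      (\<lambda>xs. (sum_list (map f xs) - (\<Sum>(s, a)\<leftarrow>zip (s # ss) (a # as). expect (P s a) f))\<^sup>2)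
      = expect (P s a) (\<lambda>x. (f x - m1)\<^sup>2 + V)"
    using Cons.hyps inner by (subst expect_next_states_Cons) (simp_all add: n_def m1_def m_def)
  also have "\<dots> \<le> expect (P s a) (\<lambda>x. 1 + V)"
    by (rule expect_mono) (use sq in auto)
  also have "\<dots> \<le> 1 + real (length ss)"
    using Cons.IH by (simp add: V_def n_def m_def)
  finally show ?case by simp
qed simp

text \<open>Follows from the variance bound by AM-GM with weight q = sqrt n, at which both halves
  contribute q / 2.\<close>

lemma expect_next_states_deviation:
  fixes P :: "'s::finite \<Rightarrow> bool \<Rightarrow> 's pmf" and f :: "'s \<Rightarrow> real"
  assumes len: "length ss = length as" and f: "\<And>x. 0 \<le> f x \<and> f x \<le> 1" and "ss \<noteq> []"
  shows "expect (next_states P ss as)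
      (\<lambda>xs. \<bar>sum_list (map f xs) - (\<Sum>(s, a)\<leftarrow>zip ss as. expect (P s a) f)\<bar>) \<le> sqrt (real (length ss))"
proof -
  define n where "n = next_states P ss as"
  define q where "q = sqrt (real (length ss))"
  define d where "d = (\<lambda>xs. sum_list (map f xs) - (\<Sum>(s, a)\<leftarrow>zip ss as. expect (P s a) f))"
  have q: "q > 0" "q * q = real (length ss)" using assms(3) by (auto simp: q_def)
  have fin: "finite (set_pmf n)" using next_states_finite[OF len] by (simp add: n_def)
  have amgm: "\<bar>x\<bar> \<le> (x\<^sup>2 / q + q) / 2" for x :: real
  proof -
    have "0 \<le> (\<bar>x\<bar> - q)\<^sup>2" by simp
    then show ?thesis using q by (simp add: field_simps power2_eq_square)
  qed
  have "expect n (\<lambda>xs. \<bar>d xs\<bar>) \<le> expect n (\<lambda>xs. ((d xs)\<^sup>2 / q + q) / 2)"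
    by (rule expect_mono[OF fin amgm])
  also have "\<dots> = (expect n (\<lambda>xs. (d xs)\<^sup>2) / q + q) / 2"
    using integrable_measure_pmf_finite[OF fin, of "\<lambda>xs. (d xs)\<^sup>2 / q"] by simp
  also have "\<dots> \<le> (q * q / q + q) / 2"
    using expect_next_states_variance[OF len f, of P] q
    by (intro divide_right_mono add_right_mono) (auto simp: n_def d_def)
  also have "\<dots> = q" using q(1) by simp
  finally show ?thesis by (simp add: n_def d_def q_def)
qed

section \<open>Dependence of the noise on state-action counts\<close>

text \<open>Expected absolute deviation of a sum over the next states, in a recursive form from which
  one can read off that it depends only on the multiset of state-action pairs.\<close>

primrec abs_dev :: "('s::finite \<Rightarrow> bool \<Rightarrow> 's pmf) \<Rightarrow> ('s \<Rightarrow> real) \<Rightarrow> ('s \<times> bool) list \<Rightarrow> real \<Rightarrow> real" where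
  "abs_dev P f [] c = \<bar>c\<bar>"
| "abs_dev P f (z # zs) c = (\<Sum>x\<in>UNIV. pmf (P (fst z) (snd z)) x * abs_dev P f zs (c + f x))"

lemma expect_finite_type:
  fixes f :: "'s::finite \<Rightarrow> real"
  shows "expect p f = (\<Sum>x\<in>UNIV. pmf p x * f x)"
  by (subst integral_measure_pmf_real[of UNIV]) (auto simp: mult.commute)

lemma sum_pmf_finite_type: "(\<Sum>x\<in>UNIV. pmf p x) = (1::real)" for p :: "'s::finite pmf"
  by (rule sum_pmf_eq_1) auto

lemma abs_dev_next_states:
  fixes P :: "'s::finite \<Rightarrow> bool \<Rightarrow> 's pmf" and f :: "'s \<Rightarrow> real"
  assumes "length ss = length as"
  shows "expect (next_states P ss as) (\<lambda>xs. \<bar>c + sum_list (map f xs)\<bar>) = abs_dev P f (zip ss as) c"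
  using assms
  by (induction ss as arbitrary: c rule: list_induct2)
    (simp_all add: expect_next_states_Cons expect_finite_type add.assoc[symmetric] del: next_states.simps(1))

text \<open>Interchanging two finite sums expresses the independence of the arms, and the offset
  only accumulates a commutative sum. Moving one element to the front is enough for invariance under
  all permutations.\<close>

lemma abs_dev_swap: "abs_dev P f (u @ z # v) c = abs_dev P f (z # u @ v) c"
proof (induction u arbitrary: c)
  case (Cons a u)
  show ?case
    by (simp add: Cons.IH sum_distrib_left add_ac)
      (subst sum.swap, simp add: mult.left_commute add.commute[of "f _" "f _"])
qed simp

lemma abs_dev_cong_mset: "mset xs = mset ys \<Longrightarrow> abs_dev P f xs c = abs_dev P f ys c"
proof (induction xs arbitrary: ys c)
  case (Cons z zs)
  then have "z \<in> set ys" by (metis list.set_intros(1) set_mset_mset)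
  then obtain u v where ys: "ys = u @ z # v" by (meson split_list)
  with Cons.prems have "mset zs = mset (u @ v)" by simp
  from Cons.IH[OF this] show ?case unfolding ys abs_dev_swap by simp
qed simp

lemma weighted_avg_diff_le:
  fixes p :: "'s::finite pmf"
  assumes "\<And>x. \<bar>g x - h x\<bar> \<le> (b::real)"
  shows "\<bar>(\<Sum>x\<in>UNIV. pmf p x * g x) - (\<Sum>x\<in>UNIV. pmf p x * h x)\<bar> \<le> b"
proof -
  have "\<bar>(\<Sum>x\<in>UNIV. pmf p x * g x) - (\<Sum>x\<in>UNIV. pmf p x * h x)\<bar> = \<bar>\<Sum>x\<in>UNIV. pmf p x * (g x - h x)\<bar>"
    by (simp add: sum_subtractf right_diff_distrib)
  also have "\<dots> \<le> (\<Sum>x\<in>UNIV. pmf p x * b)"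
    using assms by (intro sum_abs[THEN order_trans] sum_mono) (auto simp: abs_mult intro: mult_left_mono)
  also have "\<dots> = b" by (simp add: sum_distrib_right[symmetric] sum_pmf_finite_type)
  finally show ?thesis .
qed

lemma abs_dev_lipschitz: "\<bar>abs_dev P f zs c - abs_dev P f zs c'\<bar> \<le> \<bar>c - c'\<bar>"
proof (induction zs arbitrary: c c')
  case (Cons z zs)
  show ?case unfolding abs_dev.simps
  proof (rule weighted_avg_diff_le)
    show "\<bar>abs_dev P f zs (c + f x) - abs_dev P f zs (c' + f x)\<bar> \<le> \<bar>c - c'\<bar>" for x
      using Cons[of "c + f x" "c' + f x"] by simp
  qed
qed simp

text \<open>Removing one arm shifts the offset by some \<open>f x\<close>, and
  \<open>abs_dev\<close> is 1-Lipschitz in the offset.\<close>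

lemma abs_dev_append:
  assumes "\<And>x. \<bar>f x\<bar> \<le> b"
  shows "\<bar>abs_dev P f (us @ zs) c - abs_dev P f zs c\<bar> \<le> b * real (length us)"
proof (induction us arbitrary: c)
  case (Cons z us)
  have "\<bar>abs_dev P f (us @ zs) (c + f x) - abs_dev P f zs c\<bar> \<le> b * real (length (z # us))" for x
    using Cons[of "c + f x"] abs_dev_lipschitz[of P f zs "c + f x" c] assms[of x]
    by (simp add: distrib_left)
  from weighted_avg_diff_le[OF this, where p = "P (fst z) (snd z)"]
  show ?case by (simp add: sum_distrib_right[symmetric] sum_pmf_finite_type)
qed simp

text \<open>Both lists are rearranged to share the tail \<open>a\<close> of common pairs. The
  remainders \<open>u\<close> and \<open>v\<close> have equal length, and dropping each costs
  \<open>b\<close> per element; hence the factor 2.\<close>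

lemma abs_dev_mset_diff:
  fixes xs ys :: "('s::finite \<times> bool) list"
  assumes "\<And>x. \<bar>f x\<bar> \<le> b" "length xs = length ys"
  shows "\<bar>abs_dev P f xs c - abs_dev P f ys c\<bar> \<le> 2 * b * real (size (mset xs - mset ys))"
proof -
  obtain a where a: "mset a = mset xs \<inter># mset ys" by (metis ex_mset)
  obtain u where u: "mset u = mset xs - mset ys" by (metis ex_mset)
  obtain v where v: "mset v = mset ys - mset xs" by (metis ex_mset)
  have xs: "mset xs = mset (u @ a)" and ys: "mset ys = mset (v @ a)"
    by (auto simp: a u v multiset_eq_iff min_def)
  have lu: "length u = size (mset xs - mset ys)" using u by (metis size_mset)
  have "length xs = length u + length a" "length ys = length v + length a"
    using xs ys by (metis size_mset length_append)+
  then have lv: "length v = length u" using assms by simp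
  show ?thesis
    unfolding abs_dev_cong_mset[OF xs] abs_dev_cong_mset[OF ys]
    using abs_dev_append[where f = f, OF assms(1), where us = u and zs = a and c = c and P = P] abs_dev_append[where f = f, OF assms(1), where us = v and zs = a and c = c and P = P] lu lv
    by (simp add: abs_le_iff)
qed

section \<open>Peeling off eigenvalues\<close>

definition poly_apply :: "complex poly \<Rightarrow> complex^'n^'n \<Rightarrow> complex^'n \<Rightarrow> complex^'n" where
  "poly_apply p A w = (\<Sum>i\<le>degree p. coeff p i *s (((*v) A ^^ i) w))"

lemma poly_apply_altdef:
  assumes "degree p \<le> n"
  shows "poly_apply p A w = (\<Sum>i\<le>n. coeff p i *s (((*v) A ^^ i) w))"
  unfolding poly_apply_def using assms
  by (intro sum.mono_neutral_left) (auto simp: coeff_eq_0)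

lemma funpow_matrix_vector_mult:
  fixes A :: "complex^'n^'n"
  shows "((*v) A ^^ i) (A *v w) = A *v (((*v) A ^^ i) w)"
    and "((*v) A ^^ i) (v - c *s w) = ((*v) A ^^ i) v - c *s (((*v) A ^^ i) w)"
  by (induction i arbitrary: v w)
    (simp_all add: matrix_vector_mult_diff_distrib vector_scalar_commute)

text \<open>The factor X - c can be split off on either side. When the product kills w, the outer
  form makes q(A) w an eigenvector for c unless it is 0, and the inner form shows that q kills A w -
  c w.\<close>

lemma poly_apply_linear_factor:
  fixes A :: "complex^'n^'n"
  shows "poly_apply ([:- c, 1:] * q) A w = A *v poly_apply q A w - c *s poly_apply q A w"
    and "poly_apply ([:- c, 1:] * q) A w = poly_apply q A (A *v w - c *s w)"
proof -
  define n where "n = degree q"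
  define F where "F = (\<lambda>i. ((*v) A ^^ i) w)"
  have F: "F (Suc i) = A *v F i" for i by (simp add: F_def)
  have Av: "A *v poly_apply q A w = (\<Sum>i\<le>n. coeff q i *s F (Suc i))"
    by (simp add: poly_apply_def n_def F_def vec.sum vector_scalar_commute)
  have deg: "degree ([:- c, 1:] * q) \<le> Suc n"
    by (rule order_trans[OF degree_mult_le]) (simp add: n_def)
  have co: "coeff ([:- c, 1:] * q) i = (case i of 0 \<Rightarrow> 0 | Suc j \<Rightarrow> coeff q j) - c * coeff q i" for i
    by (cases i) (simp_all add: coeff_pCons)
  have "poly_apply ([:- c, 1:] * q) A w
      = (\<Sum>i\<le>Suc n. (case i of 0 \<Rightarrow> 0 | Suc j \<Rightarrow> coeff q j) *s F i) - (\<Sum>i\<le>Suc n. c *s (coeff q i *s F i))"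
    unfolding poly_apply_altdef[OF deg] co
    by (simp only: vec.scale_left_diff_distrib sum_subtractf F_def vec.scale_scale)
  also have "(\<Sum>i\<le>Suc n. (case i of 0 \<Rightarrow> 0 | Suc j \<Rightarrow> coeff q j) *s F i) = A *v poly_apply q A w"
    by (subst sum.atMost_Suc_shift) (simp add: Av)
  also have "(\<Sum>i\<le>Suc n. c *s (coeff q i *s F i)) = c *s poly_apply q A w"
    by (subst poly_apply_altdef[of q "Suc n"]) (simp_all add: n_def F_def vec.scale_sum_right)
  finally show *: "poly_apply ([:- c, 1:] * q) A w = A *v poly_apply q A w - c *s poly_apply q A w" .
  have "poly_apply q A (A *v w - c *s w) = (\<Sum>i\<le>n. coeff q i *s F (Suc i)) - c *s poly_apply q A w"
    by (simp add: poly_apply_def n_def F_def funpow_matrix_vector_mult vec.scale_right_diff_distrib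
        sum_subtractf vec.scale_sum_right mult.commute del: funpow.simps) (simp add: funpow_matrix_vector_mult)
  then show "poly_apply ([:- c, 1:] * q) A w = poly_apply q A (A *v w - c *s w)"
    using * Av by simp
qed

text \<open>The n + 1 orbit vectors w, A w, ..., A^n w are too many for dimension n.\<close>

lemma exists_annihilating_poly:
  fixes A :: "complex^'n^'n"
  obtains p where "p \<noteq> 0" "poly_apply p A w = 0"
proof -
  define F where "F = (\<lambda>i. ((*v) A ^^ i) w)"
  define n where "n = CARD('n)"
  have "\<exists>c. (\<exists>i\<le>n. c i \<noteq> 0) \<and> (\<Sum>i\<le>n. c i *s F i) = 0"
  proof (cases "inj_on F {..n}")
    \<comment> \<open>Linear dependence is a property of sets, so a repetition in the orbit needs a
      relation of its own.\<close>
    case False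
    then obtain i j where ij: "i \<le> n" "j \<le> n" "i \<noteq> j" "F i = F j" by (auto simp: inj_on_def)
    let ?c = "\<lambda>k. if k = i then 1 else if k = j then - 1 else (0::complex)"
    have "(\<Sum>k\<le>n. ?c k *s F k) = (\<Sum>k\<in>{i, j}. ?c k *s F k)"
      using ij by (intro sum.mono_neutral_right) auto
    also have "\<dots> = 0" using ij by simp
    finally show ?thesis using ij by (intro exI[of _ ?c]) auto
  next
    case True
    have "vec.dependent (F ` {..n})"
      using dim_subset_UNIV_cart_gen[of "F ` {..n}"]
      by (intro vec.dependent_biggerset_general) (simp add: card_image[OF True] n_def[symmetric])
    then obtain u v where u: "(\<Sum>v\<in>F ` {..n}. u v *s v) = 0" "v \<in> F ` {..n}" "u v \<noteq> 0"
      by (auto simp: vec.dependent_finite)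
    then show ?thesis
      by (intro exI[of _ "u \<circ> F"]) (auto simp: sum.reindex[OF True])
  qed
  then obtain c i where c: "i \<le> n" "c i \<noteq> 0" "(\<Sum>i\<le>n. c i *s F i) = 0" by blast
  define p where "p = (\<Sum>i\<le>n. monom (c i) i)"
  have co: "coeff p i = c i" if "i \<le> n" for i
    using that by (simp add: p_def coeff_sum)
  have "degree p \<le> n" unfolding p_def
    by (intro degree_sum_le) (auto intro: order_trans[OF degree_monom_le])
  then have "poly_apply p A w = 0"
    using c by (simp add: poly_apply_altdef co F_def)
  moreover have "p \<noteq> 0" using c co[of i] by auto
  ultimately show thesis using that by blast
qed

text \<open>A substitute for the Jordan decomposition: every vector is annihilated by a product of
  linear factors in A, which are stripped off one at a time.\<close>

lemma eigenvalue_peeling: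
  fixes A :: "complex^'n^'n"
  assumes zero: "0 \<in> V"
    and peel: "\<And>c u w. A *v u = c *s u \<Longrightarrow> u \<noteq> 0 \<Longrightarrow> A *v w - c *s w \<in> V \<Longrightarrow> w \<in> V"
  shows "w \<in> V"
proof -
  have "w \<in> V" if "p \<noteq> 0" "poly_apply p A w = 0" for p w
    using that
  proof (induction "degree p" arbitrary: p w)
    case 0
    then obtain a where "p = [:a:]" "a \<noteq> 0" by (metis degree_eq_zeroE pCons_0_0)
    with 0 show ?case using zero by (simp add: poly_apply_def)
  next
    case (Suc n)
    then obtain c where "poly p c = 0"
      using fundamental_theorem_of_algebra constant_degree[of p] by force
    then obtain q where q: "p = [:- c, 1:] * q" by (auto simp: poly_eq_0_iff_dvd)
    with Suc have "q \<noteq> 0" by auto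
    then have "degree p = Suc (degree q)" unfolding q by (subst degree_mult_eq) auto
    with Suc.hyps have n: "n = degree q" by simp
    show ?case
    \<comment> \<open>If \<open>q\<close> already kills \<open>w\<close>, the root \<open>c\<close>
      need not be an eigenvalue and its factor is dropped. Otherwise \<open>poly_apply q A w\<close>
      is the nonzero eigenvector that \<open>peel\<close> asks for.\<close>
    proof (cases "poly_apply q A w = 0")
      case True
      then show ?thesis using Suc.hyps(1)[OF n \<open>q \<noteq> 0\<close>] by simp
    next
      case False
      have "A *v w - c *s w \<in> V"
        using Suc.prems poly_apply_linear_factor(2)[of c q A w] q
        by (intro Suc.hyps(1)[OF n \<open>q \<noteq> 0\<close>]) simp
      moreover have "A *v poly_apply q A w = c *s poly_apply q A w"
        using Suc.prems poly_apply_linear_factor(1)[of c q A w] q by simp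
      ultimately show ?thesis using peel False by blast
    qed
  qed
  then show ?thesis using exists_annihilating_poly by metis
qed

section \<open>Roots of the characteristic polynomial and eigenvectors\<close>

lemma poly_charpoly:
  "poly (charpoly M) z = det (mat z - (\<chi> i j. complex_of_real (M i j)))"
  by (auto simp: charpoly_def det_def poly_sum poly_prod mat_def intro!: sum.cong prod.cong)

text \<open>Column eigenvectors are the form needed later: they serve as coordinates of the row
  vector X - \<mu>.\<close>

lemma eigenvalue_iff:
  "eigenvalue M z \<longleftrightarrow> (\<exists>w. w \<noteq> 0 \<and> (\<chi> i j. complex_of_real (M i j)) *v w = z *s w)"
proof -
  define A :: "complex^'a^'a" where "A = (\<chi> i j. complex_of_real (M i j))"
  have "eigenvalue M z \<longleftrightarrow> \<not> invertible (mat z - A)"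
    by (simp add: eigenvalue_def poly_charpoly A_def invertible_det_nz)
  also have "\<dots> \<longleftrightarrow> (\<exists>w. w \<noteq> 0 \<and> (mat z - A) *v w = 0)"
    by (auto simp: invertible_left_inverse matrix_left_invertible_ker)
  also have "\<dots> \<longleftrightarrow> (\<exists>w. w \<noteq> 0 \<and> A *v w = z *s w)"
  proof -
    have "(mat z - A) *v w = z *s w - A *v w" for w
    by (simp add: matrix_vector_mult_diff_rdistrib) 
      (simp add: vec_eq_iff matrix_vector_mult_def mat_def if_distrib if_distribR cong: if_cong)
    then show ?thesis by (metis right_minus_eq)
  qed
  finally show ?thesis by (simp add: A_def)
qed

section \<open>Sharpness of a unique LP optimum\<close>

definition off_mass :: "('s::finite \<Rightarrow> bool \<Rightarrow> real) \<Rightarrow> ('s \<Rightarrow> bool \<Rightarrow> real) \<Rightarrow> real" where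
  "off_mass y z = (\<Sum>s\<in>UNIV. \<Sum>a\<in>UNIV. if y s a = 0 then z s a else 0)"

text \<open>On the compact set of unit vectors of the cone \<open>f\<close> attains a largest value,
  which is negative; homogeneity extends the bound to the cone. Without unit vectors the cone
  contains nothing but possibly 0.\<close>

lemma linear_on_cone_sharp:
  fixes D :: "'a::euclidean_space set" and f :: "'a \<Rightarrow> real"
  assumes "closed D" and cone: "\<And>c d. d \<in> D \<Longrightarrow> c > 0 \<Longrightarrow> c *\<^sub>R d \<in> D"
    and lin: "linear f" and neg: "\<And>d. d \<in> D \<Longrightarrow> d \<noteq> 0 \<Longrightarrow> f d < 0"
  obtains k where "k > 0" "\<And>d. d \<in> D \<Longrightarrow> f d \<le> - k * norm d"
proof (cases "D \<inter> sphere 0 1 = {}")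
  case True
  have "d = 0" if "d \<in> D" for d
  proof (rule ccontr)
    assume "d \<noteq> 0"
    then have "(1 / norm d) *\<^sub>R d \<in> D \<inter> sphere 0 1" using cone[OF that, of "1 / norm d"] by simp
    then show False using True by blast
  qed
  then show thesis using that[of 1] linear_0[OF lin] by force
next
  case False
  have "compact (D \<inter> sphere 0 1)" using assms(1) by (intro closed_Int_compact) auto
  moreover have "continuous_on (D \<inter> sphere 0 1) f"
    using lin by (simp add: linear_continuous_on linear_linear)
  ultimately obtain d0 where d0: "d0 \<in> D \<inter> sphere 0 1" "\<And>d. d \<in> D \<inter> sphere 0 1 \<Longrightarrow> f d \<le> f d0"
    using continuous_attains_sup[of "D \<inter> sphere 0 1" f] False by blast
  have "d0 \<noteq> 0" using d0(1) by auto
  then have "f d0 < 0" using neg[of d0] d0(1) by simp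
  moreover have "f d \<le> - (- f d0) * norm d" if "d \<in> D" for d
  proof (cases "d = 0")
    case True
    then show ?thesis using linear_0[OF lin] by simp
  next
    case False
    then have "(1 / norm d) *\<^sub>R d \<in> D \<inter> sphere 0 1" using cone[OF that, of "1 / norm d"] by simp
    from d0(2)[OF this] have "f d / norm d \<le> f d0"
      using linear_scale[OF lin, of "1 / norm d" d] by simp
    then show ?thesis using False by (simp add: divide_le_eq)
  qed
  ultimately show thesis using that[of "- f d0"] by simp
qed

text \<open>Feasible directions at a unique optimum form a closed cone on which the objective is
  negative, hence bounded away from zero on unit directions.\<close>

lemma lp_unique_optimum_sharp:
  fixes P :: "'s::finite \<Rightarrow> bool \<Rightarrow> 's pmf" and r y :: "'s \<Rightarrow> bool \<Rightarrow> real"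
  assumes opt: "lp_optimal P r \<alpha> y" and uniq: "\<And>z. lp_optimal P r \<alpha> z \<Longrightarrow> z = y"
  obtains k where "k > 0" "\<And>z. lp_feasible P \<alpha> z \<Longrightarrow> k * off_mass y z \<le> lp_obj r y - lp_obj r z"
proof -
  \<comment> \<open>The tangent cone of the feasible set at \<open>y\<close>: equalities are
    homogenized, and a sign constraint remains only at coordinates where \<open>y\<close>
    vanishes.\<close>
  define D :: "(real^('s \<times> bool)) set" where "D = {d. (\<Sum>s\<in>UNIV. d $ (s, True)) = 0 \<and>
     (\<forall>s. (\<Sum>s'\<in>UNIV. \<Sum>a\<in>UNIV. d $ (s', a) * pmf (P s' a) s) = (\<Sum>a\<in>UNIV. d $ (s, a))) \<and>
     (\<Sum>s\<in>UNIV. \<Sum>a\<in>UNIV. d $ (s, a)) = 0 \<and> (\<forall>s a. y s a = 0 \<longrightarrow> 0 \<le> d $ (s, a))}"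
  define f :: "real^('s \<times> bool) \<Rightarrow> real" where "f d = (\<Sum>s\<in>UNIV. \<Sum>a\<in>UNIV. r s a * d $ (s, a))" for d
  have feas: "lp_feasible P \<alpha> y" using opt by (simp add: lp_optimal_def)
  have cl: "closed D" unfolding D_def
    by (intro closed_Collect_conj closed_Collect_all closed_Collect_eq closed_Collect_imp
        closed_Collect_le open_Collect_const continuous_intros)
  have cone: "c *\<^sub>R d \<in> D" if "d \<in> D" "c > 0" for c d
    using that unfolding D_def
    by (auto simp: sum_distrib_left[symmetric] mult.assoc)
  have lin: "linear f"
    by (rule linearI) (simp_all add: f_def sum.distrib algebra_simps sum_distrib_left)
  have neg: "f d < 0" if d: "d \<in> D" "d \<noteq> 0" for d
  proof -
    \<comment> \<open>The least positive entry of \<open>y\<close>, capped by the 1 that keeps the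
      set nonempty. The step length \<open>e\<close> below is chosen so that no entry moves by more
      than \<open>m\<close>, hence positive entries stay nonnegative.\<close>
    define m where "m = Min (insert 1 ((\<lambda>(s, a). y s a) ` {(s, a). y s a > 0}))"
    have m: "m > 0" unfolding m_def by (subst Min_gr_iff) auto
    have m_le: "m \<le> y s a" if "y s a > 0" for s a
      unfolding m_def using that by (intro Min_le) (auto intro!: image_eqI[of _ _ "(s, a)"])
    define e where "e = m / (1 + norm d)"
    have n1: "1 + norm d > 0" by (simp add: add_pos_nonneg)
    have e: "e > 0" using m n1 by (simp add: e_def)
    define z where "z = (\<lambda>s a. y s a + e * d $ (s, a))"
    have "0 \<le> z s a" for s a
    proof (cases "y s a = 0")
      case True
      then show ?thesis using d(1) e by (auto simp: z_def D_def)
    next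
      case False
      then have "m \<le> y s a" using feas m_le by (auto simp: lp_feasible_def less_le)
      moreover have "e * \<bar>d $ (s, a)\<bar> \<le> e * (1 + norm d)"
        using e component_le_norm_cart[of d "(s, a)"] by (intro mult_left_mono) auto
      moreover have "e * (1 + norm d) = m" using n1 by (simp add: e_def)
      moreover have "\<bar>e * d $ (s, a)\<bar> = e * \<bar>d $ (s, a)\<bar>" using e by (simp add: abs_mult)
      ultimately show ?thesis unfolding z_def by linarith
    qed
    then have zf: "lp_feasible P \<alpha> z"
      using feas d(1) unfolding lp_feasible_def z_def D_def
      by (auto simp: sum.distrib distrib_right sum_distrib_left[symmetric] mult.assoc)
    have "z \<noteq> y"
    proof
      assume "z = y"
      then have "d $ (s, a) = 0" for s a using e by (auto simp: z_def fun_eq_iff)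
      then show False using d(2) by (auto simp: vec_eq_iff)
    qed
    have "lp_obj r z < lp_obj r y"
    proof (rule ccontr)
      assume "\<not> lp_obj r z < lp_obj r y"
      then have "lp_optimal P r \<alpha> z" using opt zf unfolding lp_optimal_def by force
      then show False using uniq \<open>z \<noteq> y\<close> by blast
    qed
    moreover have "lp_obj r z = lp_obj r y + e * f d"
      by (simp add: lp_obj_def z_def f_def sum.distrib distrib_left sum_distrib_left mult_ac)
    ultimately show ?thesis using e by (simp add: mult_less_0_iff)
  qed
  obtain k where k: "k > 0" "\<And>d. d \<in> D \<Longrightarrow> f d \<le> - k * norm d"
    using linear_on_cone_sharp[OF cl cone lin neg] by blast
  define n where "n = real CARD('s \<times> bool)"
  have n: "n > 0" unfolding n_def by (simp add: card_gt_0_iff del: card_prod)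
  have "k / n * off_mass y z \<le> lp_obj r y - lp_obj r z" if z: "lp_feasible P \<alpha> z" for z
  proof -
    define d :: "real^('s \<times> bool)" where "d = (\<chi> p. z (fst p) (snd p) - y (fst p) (snd p))"
    have "d \<in> D" using z feas unfolding D_def d_def lp_feasible_def
      by (auto simp: sum_subtractf left_diff_distrib)
    then have "f d \<le> - k * norm d" by (rule k)
    moreover have "f d = lp_obj r z - lp_obj r y"
      by (simp add: f_def d_def lp_obj_def sum_subtractf right_diff_distrib)
    moreover have "off_mass y z \<le> n * norm d"
    proof -
      have "off_mass y z \<le> (\<Sum>s\<in>(UNIV::'s set). \<Sum>a\<in>(UNIV::bool set). norm d)"
        unfolding off_mass_def
      proof (intro sum_mono)
        fix s a show "(if y s a = 0 then z s a else 0) \<le> norm d"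
          using component_le_norm_cart[of d "(s, a)"] by (auto simp: d_def)
      qed
      also have "\<dots> = n * norm d" by (simp add: n_def)
      finally show ?thesis .
    qed
    then have "k * off_mass y z / n \<le> k * norm d"
      using k n by (simp add: divide_le_eq mult.assoc mult.left_commute[of k] mult.commute[of "norm d"])
    ultimately show ?thesis by simp
  qed
  then show thesis using that[of "k / n"] k(1) n by simp
qed

section \<open>Empirical state-action frequencies\<close>

definition sa_freq :: "'s list \<Rightarrow> bool list \<Rightarrow> 's \<Rightarrow> bool \<Rightarrow> real" where
  "sa_freq ss as s a = real (count (mset (zip ss as)) (s, a)) / real (length ss)"

lemma sum_list_eq_sum_count:
  fixes g :: "'a::finite \<Rightarrow> real"
  shows "(\<Sum>z\<leftarrow>zs. g z) = (\<Sum>z\<in>UNIV. real (count (mset zs) z) * g z)"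
proof (induction zs)
  case (Cons x zs)
  have "real (count (mset (x # zs)) z) * g z = (if z = x then g z else 0) + real (count (mset zs) z) * g z" for z
    by (simp add: algebra_simps)
  then show ?case using Cons by (simp only: sum.distrib list.map sum_list.Cons) simp
qed simp

lemma count_mset_conv_card: "count (mset xs) x = card {i. i < length xs \<and> xs ! i = x}"
  by (simp add: count_mset count_list_eq_length_filter length_filter_conv_card eq_commute)

lemma X_of_eq_count: "X_of ss s = real (count (mset ss) s) / real (length ss)"
  by (simp add: X_of_def count_st_def count_mset_conv_card)

lemma X_of_eq_sum_list: "X_of ss s = sum_list (map (indicator {s}) ss) / real (length ss)"
proof -
  have "sum_list (map (indicator {s}) ss) = real (count (mset ss) s)"
    by (induction ss) (auto simp: indicator_def)
  then show ?thesis by (simp add: X_of_eq_count)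
qed

lemma sum_UNIV_pair: "(\<Sum>s\<in>(UNIV::'a::finite set). \<Sum>a\<in>(UNIV::'b::finite set). g s a) = (\<Sum>p\<in>UNIV. g (fst p) (snd p))"
  by (simp add: sum.cartesian_product case_prod_beta)

lemma sum_sa_freq:
  fixes ss :: "'s::finite list"
  shows "(\<Sum>s\<in>UNIV. \<Sum>a\<in>UNIV. sa_freq ss as s a * g s a) = (\<Sum>(s, a)\<leftarrow>zip ss as. g s a) / real (length ss)"
  unfolding sum_UNIV_pair
  by (simp add: sa_freq_def sum_list_eq_sum_count sum_divide_distrib case_prod_beta)

lemma sum_X_of: "ss \<noteq> [] \<Longrightarrow> (\<Sum>s\<in>(UNIV::'s::finite set). X_of ss s) = 1"
  using sum_list_eq_sum_count[of "\<lambda>_. 1" ss]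
  by (simp add: X_of_eq_count sum_divide_distrib[symmetric] sum_list_triv flip: of_nat_sum)

lemma X_of_bounds: "0 \<le> X_of ss s" "X_of ss s \<le> 1"
  unfolding X_of_eq_count using count_le_size[of "mset ss" s]
  by (auto simp: divide_le_eq_1)

lemma sa_freq_nonneg: "0 \<le> sa_freq ss as s a"
  by (simp add: sa_freq_def)

lemma sa_freq_le_1: "sa_freq ss as s a \<le> 1"
proof -
  have "count (mset (zip ss as)) (s, a) \<le> length ss"
    using count_le_size[of "mset (zip ss as)" "(s, a)"] by simp
  then show ?thesis by (auto simp: sa_freq_def divide_le_eq_1)
qed

lemma count_mset_zip_sum:
  assumes "length ss = length as"
  shows "count (mset (zip ss as)) (s, False) + count (mset (zip ss as)) (s, True) = count (mset ss) s"
  using assms by (induction ss as rule: list_induct2) auto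

lemma sa_freq_marginal:
  assumes "length ss = length as"
  shows "sa_freq ss as s False + sa_freq ss as s True = X_of ss s"
  unfolding sa_freq_def X_of_eq_count
  by (simp add: add_divide_distrib[symmetric] of_nat_add[symmetric] count_mset_zip_sum[OF assms] del: of_nat_add)

lemma sum_count_True:
  fixes ss :: "'s::finite list"
  assumes "length ss = length as"
  shows "(\<Sum>s\<in>UNIV. count (mset (zip ss as)) (s, True)) = card {i. i < length ss \<and> as ! i}"
proof -
  have "(\<Sum>s\<in>UNIV. count (mset (zip ss as)) (s, True)) = length (filter id as)"
    using assms
  proof (induction ss as rule: list_induct2)
    case (Cons s ss a as)
    have "count (mset (zip (s # ss) (a # as))) (x, True)
        = (if x = s then of_bool a else 0) + count (mset (zip ss as)) (x, True)" for x
      by (cases a) auto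
    then show ?case using Cons by (simp only: sum.distrib) simp
  qed simp
  then show ?thesis using assms by (simp add: length_filter_conv_card)
qed

section \<open>Linear dynamics around the optimum\<close>

text \<open>The estimates for sums are applied to the indicator of \<open>t\<close>; dividing by N
  turns sqrt N into 1 / sqrt N.\<close>

lemma expect_X_of:
  fixes P :: "'s::finite \<Rightarrow> bool \<Rightarrow> 's pmf"
  assumes "length ss = length as" "ss \<noteq> []"
  shows "expect (next_states P ss as) (\<lambda>xs. X_of xs t)
       = (\<Sum>s\<in>UNIV. \<Sum>a\<in>UNIV. sa_freq ss as s a * pmf (P s a) t)" (is "?E = ?m")
    and "expect (next_states P ss as) (\<lambda>xs. \<bar>X_of xs t - (\<Sum>s\<in>UNIV. \<Sum>a\<in>UNIV. sa_freq ss as s a * pmf (P s a) t)\<bar>)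
       \<le> 1 / sqrt (real (length ss))" (is "?D \<le> _")
proof -
  define n where "n = real (length ss)"
  define f :: "'s \<Rightarrow> real" where "f = indicator {t}"
  have n: "n > 0" using assms(2) by (simp add: n_def)
  have Ef: "expect (P s a) f = pmf (P s a) t" for s a
    by (simp add: f_def pmf.rep_eq measure_pmf.prob_space_axioms)
  have X: "X_of xs t = sum_list (map f xs) / n" if "xs \<in> set_pmf (next_states P ss as)" for xs
    using next_states_support[OF assms(1), of P] that by (auto simp: X_of_eq_sum_list f_def n_def)
  define S where "S = (\<Sum>(s, a)\<leftarrow>zip ss as. expect (P s a) f)"
  have m: "?m = S / n" by (simp add: sum_sa_freq S_def n_def Ef)
  have "?E = expect (next_states P ss as) (\<lambda>xs. sum_list (map f xs) / n)"
    by (rule expect_cong) (rule X)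
  also have "\<dots> = S / n"
    by (simp add: expect_next_states_sum_list[OF assms(1)] S_def)
  finally show "?E = ?m" by (simp add: m)
  have "?D = expect (next_states P ss as) (\<lambda>xs. \<bar>sum_list (map f xs) - S\<bar> / n)"
    unfolding m using n by (intro expect_cong) (simp add: X diff_divide_distrib[symmetric])
  also have "\<dots> \<le> sqrt n / n"
    using expect_next_states_deviation[OF assms(1) _ assms(2), of f P] n
    by (simp add: S_def n_def f_def divide_right_mono indicator_def)
  also have "\<dots> = 1 / sqrt n" using n by (simp add: real_div_sqrt field_simps)
  finally show "?D \<le> 1 / sqrt (real (length ss))" by (simp add: n_def)
qed

text \<open>What the dynamics uses of the optimum: by full support and uniqueness of
  \<open>st\<close>, each state other than \<open>st\<close> has exactly one right action.
  Optimality enters later through the sharpness estimate.\<close>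

locale neutral_lp =
  fixes P :: "'s::finite \<Rightarrow> bool \<Rightarrow> 's pmf" and \<alpha> :: real
    and y :: "'s \<Rightarrow> bool \<Rightarrow> real" and st :: 's
  assumes feas: "lp_feasible P \<alpha> y"
    and full: "mu_of y s > 0"
    and st_pos: "y st False > 0" "y st True > 0"
    and st_unique: "y s False > 0 \<Longrightarrow> y s True > 0 \<Longrightarrow> s = st"
begin

definition budgeted :: "'s list \<Rightarrow> bool list \<Rightarrow> bool" where
  "budgeted ss as \<longleftrightarrow> ss \<noteq> [] \<and> length as = length ss \<and>
     real (card {i. i < length ss \<and> as ! i}) = \<alpha> * real (length ss)"

abbreviation wrong :: "'s list \<Rightarrow> bool list \<Rightarrow> real" where
  "wrong ss as \<equiv> off_mass y (sa_freq ss as)"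

abbreviation "\<mu> \<equiv> mu_of y"
abbreviation "\<Phi> \<equiv> Phi_mat P \<alpha> y st"

lemma y_nonneg: "0 \<le> y s a"
  using feas by (auto simp: lp_feasible_def)

lemma sum_mu: "(\<Sum>s\<in>UNIV. \<mu> s) = 1"
  using feas by (simp add: lp_feasible_def mu_of_def UNIV_bool add.commute)

lemma pibar_mu: "pibar y a s * \<mu> s = y s a"
  using full[of s] by (simp add: pibar_def)

lemma pibar_False: "pibar y False s = 1 - pibar y True s"
  using full[of s] by (simp add: pibar_def mu_of_def field_simps)

text \<open>\<mu> is stationary for \<open>P_pibar\<close>, the rank-one term subtracts it again
  since its entries sum to 1, and c - \<alpha> has mean 0 under it because \<open>y\<close> meets
  the budget. Consequently X may replace X - \<mu> under Phi, and unstable eigenvectors are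
  orthogonal to \<mu>.\<close>

lemma mu_Phi: "(\<Sum>s\<in>UNIV. \<mu> s * \<Phi> s t) = 0"
proof -
  have flow: "(\<Sum>s\<in>UNIV. \<Sum>a\<in>UNIV. y s a * pmf (P s a) t) = \<mu> t"
    using feas by (simp add: lp_feasible_def mu_of_def UNIV_bool add.commute)
  have budget: "(\<Sum>s\<in>UNIV. y s True) = \<alpha>"
    using feas by (simp add: lp_feasible_def)
  define D where "D = pmf (P st True) t - pmf (P st False) t"
  have "\<mu> s * \<Phi> s t = (\<Sum>a\<in>UNIV. y s a * pmf (P s a) t) - \<mu> s * \<mu> t - (y s True - \<alpha> * \<mu> s) * D" for s
    unfolding Phi_mat_def P_pibar_def D_def[symmetric]
    by (simp add: pibar_mu[symmetric] algebra_simps sum_distrib_left)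
  then have "(\<Sum>s\<in>UNIV. \<mu> s * \<Phi> s t) = (\<Sum>s\<in>UNIV. \<Sum>a\<in>UNIV. y s a * pmf (P s a) t)
      - (\<Sum>s\<in>UNIV. \<mu> s) * \<mu> t - ((\<Sum>s\<in>UNIV. y s True) - \<alpha> * (\<Sum>s\<in>UNIV. \<mu> s)) * D"
    by (simp add: sum_subtractf sum_distrib_right[symmetric] sum_distrib_left[symmetric])
  then show ?thesis by (simp add: flow budget sum_mu)
qed

lemma budgeted_sum_True: "budgeted ss as \<Longrightarrow> (\<Sum>s\<in>UNIV. sa_freq ss as s True) = \<alpha>"
  using sum_count_True[of ss as]
  by (simp add: budgeted_def sa_freq_def sum_divide_distrib[symmetric] flip: of_nat_sum)

lemma off_term_nonneg: "0 \<le> (\<Sum>a\<in>UNIV. if y s a = 0 then sa_freq ss as s a else 0)"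
  by (intro sum_nonneg) (simp add: sa_freq_nonneg)

lemma wrong_nonneg: "0 \<le> wrong ss as"
  unfolding off_mass_def by (intro sum_nonneg off_term_nonneg)

lemma inactive_or_active:
  assumes "s \<noteq> st"
  shows "(y s True = 0 \<and> y s False > 0) \<or> (y s False = 0 \<and> y s True > 0)"
  using st_unique[of s] assms y_nonneg[of s True] y_nonneg[of s False] full[of s]
  by (auto simp: mu_of_def less_le)

text \<open>The neutral state absorbs the budget, so its own deviation cancels and only wrong actions
  move the conditional mean away from the linear dynamics.\<close>

lemma drift:
  assumes b: "budgeted ss as"
  shows "\<bar>(\<Sum>s\<in>UNIV. \<Sum>a\<in>UNIV. sa_freq ss as s a * pmf (P s a) t) - \<mu> t
      - (\<Sum>s\<in>UNIV. (X_of ss s - \<mu> s) * \<Phi> s t)\<bar> \<le> 2 * wrong ss as" (is "\<bar>?lhs\<bar> \<le> _")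
proof -
  define x where "x = X_of ss"
  define Y where "Y = sa_freq ss as"
  define c where "c s = pibar y True s" for s
  \<comment> \<open>The active mass in excess of the rule \<open>c\<close>. By the budget its total
    is \<alpha> minus the sum of \<open>c s * x s\<close>, which is the coefficient of
    \<open>D st\<close> produced by Phi; the excess in \<open>st\<close> itself therefore
    cancels.\<close>
  define dl where "dl s = Y s True - c s * x s" for s
  define D where "D s = pmf (P s True) t - pmf (P s False) t" for s
  have len: "length ss = length as" "ss \<noteq> []" using b by (auto simp: budgeted_def)
  have YF: "Y s False = x s - Y s True" for s
    using sa_freq_marginal[OF len(1), of s] by (simp add: Y_def x_def)
  have sx: "(\<Sum>s\<in>UNIV. x s) = 1" unfolding x_def by (rule sum_X_of[OF len(2)])
  have sY: "(\<Sum>s\<in>UNIV. Y s True) = \<alpha>" unfolding Y_def by (rule budgeted_sum_True[OF b])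
  have "(\<Sum>s\<in>UNIV. (x s - \<mu> s) * \<Phi> s t) = (\<Sum>s\<in>UNIV. x s * \<Phi> s t)"
    using mu_Phi[of t] by (simp add: left_diff_distrib sum_subtractf)
  also have "\<dots> = (\<Sum>s\<in>UNIV. x s * (c s * pmf (P s True) t + (1 - c s) * pmf (P s False) t))
      - (\<Sum>s\<in>UNIV. x s) * \<mu> t - ((\<Sum>s\<in>UNIV. c s * x s) - \<alpha> * (\<Sum>s\<in>UNIV. x s)) * D st"
    by (simp add: Phi_mat_def P_pibar_def UNIV_bool pibar_False c_def[symmetric] D_def[symmetric]
        sum_subtractf[symmetric] sum_distrib_left sum_distrib_right algebra_simps)
  also have "\<dots> = (\<Sum>s\<in>UNIV. x s * (c s * pmf (P s True) t + (1 - c s) * pmf (P s False) t))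
      - \<mu> t + (\<Sum>s\<in>UNIV. dl s * D st)"
    by (simp add: sx sY[symmetric] dl_def sum_subtractf sum_distrib_right[symmetric] left_diff_distrib)
  finally have "?lhs = (\<Sum>s\<in>UNIV. \<Sum>a\<in>UNIV. Y s a * pmf (P s a) t)
      - (\<Sum>s\<in>UNIV. x s * (c s * pmf (P s True) t + (1 - c s) * pmf (P s False) t))
      - (\<Sum>s\<in>UNIV. dl s * D st)"
    by (simp add: x_def Y_def)
  also have "\<dots> = (\<Sum>s\<in>UNIV. dl s * (D s - D st))"
    by (simp add: sum_subtractf[symmetric] UNIV_bool YF dl_def D_def algebra_simps)
  finally have "\<bar>?lhs\<bar> \<le> (\<Sum>s\<in>UNIV. \<bar>dl s * (D s - D st)\<bar>)" by simp
  also have "\<dots> \<le> (\<Sum>s\<in>UNIV. 2 * (\<Sum>a\<in>UNIV. if y s a = 0 then Y s a else 0))"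
  proof (intro sum_mono)
    fix s
    show "\<bar>dl s * (D s - D st)\<bar> \<le> 2 * (\<Sum>a\<in>UNIV. if y s a = 0 then Y s a else 0)"
    proof (cases "s = st")
      case True
      then show ?thesis using off_term_nonneg[of s ss as] unfolding Y_def by simp
    next
      case False
      have p: "0 \<le> pmf (P s' a) t \<and> pmf (P s' a) t \<le> 1" for s' a by (simp add: pmf_le_1)
      have "\<bar>D s'\<bar> \<le> 1" for s' using p[of s' True] p[of s' False] unfolding D_def by linarith
      from this[of s] this[of st] have D: "\<bar>D s - D st\<bar> \<le> 2" by linarith
      \<comment> \<open>Away from \<open>st\<close> the rule \<open>c\<close> is 0 or 1, so the
        excess is, up to sign, the wrong mass of the state.\<close>
      have "\<bar>dl s\<bar> = (\<Sum>a\<in>UNIV. if y s a = 0 then Y s a else 0)"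
        using inactive_or_active[OF False] YF[of s] sa_freq_nonneg[of ss as s False] sa_freq_nonneg[of ss as s True]
        by (auto simp: UNIV_bool dl_def c_def pibar_def mu_of_def Y_def)
      then show ?thesis using mult_mono[OF order_refl D, of "\<bar>dl s\<bar>"]
        by (simp add: abs_mult mult.commute)
    qed
  qed
  finally show ?thesis unfolding off_mass_def Y_def by (simp add: sum_distrib_left)
qed

section \<open>One-step bounds for linear coordinates of the deviation\<close>

definition step_dev :: "'s list \<Rightarrow> 's list \<Rightarrow> 's \<Rightarrow> real" where
  "step_dev ss xs t = X_of xs t - \<mu> t - (\<Sum>s\<in>UNIV. (X_of ss s - \<mu> s) * \<Phi> s t)"

definition proj :: "complex^'s \<Rightarrow> 's list \<Rightarrow> complex" where
  "proj w ss = (\<Sum>s\<in>UNIV. of_real (X_of ss s - \<mu> s) * w $ s)"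

definition Phi_c :: "complex^'s^'s" where
  "Phi_c = (\<chi> i j. complex_of_real (\<Phi> i j))"

text \<open>With row vectors for states, the image of X - \<mu> under Phi, tested against w, is X -
  \<mu> tested against Phi w. The dynamics thus moves onto the test vector.\<close>

lemma proj_step: "proj w xs - proj (Phi_c *v w) ss = (\<Sum>t\<in>UNIV. of_real (step_dev ss xs t) * w $ t)"
proof -
  have "proj (Phi_c *v w) ss = (\<Sum>s\<in>UNIV. \<Sum>t\<in>UNIV. of_real ((X_of ss s - \<mu> s) * \<Phi> s t) * w $ t)"
    by (simp add: proj_def Phi_c_def matrix_vector_mult_def sum_distrib_left mult.assoc)
  also have "\<dots> = (\<Sum>t\<in>UNIV. of_real (\<Sum>s\<in>UNIV. (X_of ss s - \<mu> s) * \<Phi> s t) * w $ t)"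
    by (subst sum.swap) (simp add: sum_distrib_right)
  finally show ?thesis
    by (simp add: proj_def step_dev_def sum_subtractf left_diff_distrib)
qed

lemma proj_linear:
  "proj (v - w) ss = proj v ss - proj w ss"
  "proj (c *s w) ss = c * proj w ss" "proj 0 ss = 0"
  by (simp_all add: proj_def sum_subtractf right_diff_distrib
      sum_distrib_left mult.left_commute)

definition wt :: "complex^'s \<Rightarrow> real" where "wt w = (\<Sum>s\<in>UNIV. cmod (w $ s))"

lemma wt_nonneg: "0 \<le> wt w" by (simp add: wt_def sum_nonneg)

lemma mu_bounds: "0 \<le> \<mu> s" "\<mu> s \<le> 1"
proof -
  show "0 \<le> \<mu> s" using full[of s] by simp
  have "\<mu> s \<le> (\<Sum>s\<in>UNIV. \<mu> s)" using full by (intro member_le_sum) (auto intro: less_imp_le)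
  then show "\<mu> s \<le> 1" by (simp add: sum_mu)
qed

lemma proj_bound: "cmod (proj w ss) \<le> wt w"
  unfolding proj_def wt_def
proof (intro order_trans[OF norm_sum] sum_mono)
  fix s
  have "\<bar>X_of ss s - \<mu> s\<bar> \<le> 1" using X_of_bounds[of ss s] mu_bounds[of s] by linarith
  then show "cmod (of_real (X_of ss s - \<mu> s) * w $ s) \<le> cmod (w $ s)"
    unfolding norm_mult norm_of_real by (rule mult_left_le_one_le[rotated 2]) simp_all
qed

text \<open>The first bound pays for noise and drift. The second takes the expectation inside the
  modulus, where the noise has mean 0, so that only the drift error is left; this is what gives the
  expanding coordinate a bound without 1 / sqrt N.\<close>

lemma expect_proj_step:
  assumes b: "budgeted ss as"
  shows "expect (next_states P ss as) (\<lambda>xs. cmod (proj w xs - proj (Phi_c *v w) ss))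
      \<le> wt w * (1 / sqrt (real (length ss)) + 2 * wrong ss as)"
    and "cmod (proj (Phi_c *v w) ss) \<le> expect (next_states P ss as) (\<lambda>xs. cmod (proj w xs)) + wt w * 2 * wrong ss as"
proof -
  define n where "n = next_states P ss as"
  have len: "length ss = length as" "ss \<noteq> []" using b by (auto simp: budgeted_def)
  have fin: "finite (set_pmf n)" unfolding n_def by (rule next_states_finite[OF len(1)])
  note int = integrable_measure_pmf_finite[OF fin]
  define m where "m t = (\<Sum>s\<in>UNIV. \<Sum>a\<in>UNIV. sa_freq ss as s a * pmf (P s a) t)" for t
  have dr: "\<bar>m t - \<mu> t - (\<Sum>s\<in>UNIV. (X_of ss s - \<mu> s) * \<Phi> s t)\<bar> \<le> 2 * wrong ss as" for t
    unfolding m_def by (rule drift[OF b])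
  have dev: "expect n (\<lambda>xs. \<bar>step_dev ss xs t\<bar>) \<le> 1 / sqrt (real (length ss)) + 2 * wrong ss as" for t
  proof -
    have "expect n (\<lambda>xs. \<bar>step_dev ss xs t\<bar>) \<le> expect n (\<lambda>xs. \<bar>X_of xs t - m t\<bar> + 2 * wrong ss as)"
      using dr[of t] by (intro expect_mono[OF fin]) (simp add: step_dev_def)
    also have "\<dots> = expect n (\<lambda>xs. \<bar>X_of xs t - m t\<bar>) + 2 * wrong ss as"
      by (subst Bochner_Integration.integral_add) (auto intro: int)
    finally show ?thesis using expect_X_of(2)[OF len, of P t] by (simp add: n_def m_def)
  qed
  have "expect n (\<lambda>xs. cmod (proj w xs - proj (Phi_c *v w) ss))
      \<le> expect n (\<lambda>xs. \<Sum>t\<in>UNIV. \<bar>step_dev ss xs t\<bar> * cmod (w $ t))"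
    unfolding proj_step by (intro expect_mono[OF fin] order_trans[OF norm_sum]) (simp add: norm_mult)
  also have "\<dots> = (\<Sum>t\<in>UNIV. expect n (\<lambda>xs. \<bar>step_dev ss xs t\<bar>) * cmod (w $ t))"
    by (subst Bochner_Integration.integral_sum) (auto intro: int)
  also have "\<dots> \<le> (\<Sum>t\<in>UNIV. (1 / sqrt (real (length ss)) + 2 * wrong ss as) * cmod (w $ t))"
    by (intro sum_mono mult_right_mono dev) simp
  finally show "expect (next_states P ss as) (\<lambda>xs. cmod (proj w xs - proj (Phi_c *v w) ss))
      \<le> wt w * (1 / sqrt (real (length ss)) + 2 * wrong ss as)"
    by (simp add: n_def wt_def sum_distrib_right mult.commute)
  have Edev: "\<bar>expect n (\<lambda>xs. step_dev ss xs t)\<bar> \<le> 2 * wrong ss as" for t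
  proof -
    have "expect n (\<lambda>xs. step_dev ss xs t) = m t - \<mu> t - (\<Sum>s\<in>UNIV. (X_of ss s - \<mu> s) * \<Phi> s t)"
      unfolding step_dev_def diff_diff_eq m_def expect_X_of(1)[OF len, of P t, folded n_def, symmetric]
      by (subst Bochner_Integration.integral_diff) (auto intro: int)
    then show ?thesis using dr by simp
  qed
  have "expect n (proj w) - proj (Phi_c *v w) ss = expect n (\<lambda>xs. proj w xs - proj (Phi_c *v w) ss)"
    by (subst Bochner_Integration.integral_diff) (auto intro: int)
  also have "\<dots> = (\<Sum>t\<in>UNIV. of_real (expect n (\<lambda>xs. step_dev ss xs t)) * w $ t)"
    unfolding proj_step by (subst Bochner_Integration.integral_sum) (auto intro: int)
  also have "cmod \<dots> \<le> (\<Sum>t\<in>UNIV. 2 * wrong ss as * cmod (w $ t))"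
    by (intro order_trans[OF norm_sum] sum_mono) (simp add: norm_mult mult_right_mono Edev)
  also have "\<dots> = wt w * 2 * wrong ss as" by (simp add: wt_def sum_distrib_left mult_ac)
  finally have "cmod (proj (Phi_c *v w) ss) \<le> cmod (expect n (proj w)) + wt w * 2 * wrong ss as"
    using norm_triangle_sub[of "proj (Phi_c *v w) ss" "expect n (proj w)"]
    by (simp add: norm_minus_commute)
  also have "cmod (expect n (proj w)) \<le> expect n (\<lambda>xs. cmod (proj w xs))"
    by (rule integral_norm_bound)
  finally show "cmod (proj (Phi_c *v w) ss) \<le> expect (next_states P ss as) (\<lambda>xs. cmod (proj w xs)) + wt w * 2 * wrong ss as"
    by (simp add: n_def)
qed

end

section \<open>Optimal local control\<close>

text \<open>OLC serves the arms in \<open>st\<close> in index order. The count shows that it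
  activates exactly the remaining budget there, provided that enough arms are available.\<close>

lemma card_first_occurrences:
  fixes n :: nat
  shows "card {i. i < n \<and> Q i \<and> int (card {j. j < i \<and> Q j}) < m} = min (nat m) (card {i. i < n \<and> Q i})"
proof (induction n)
  case (Suc n)
  let ?R = "\<lambda>i. int (card {j. j < i \<and> Q j}) < m"
  have 1: "{i. i < Suc n \<and> Q i \<and> ?R i} = (if Q n \<and> ?R n then insert n else id) {i. i < n \<and> Q i \<and> ?R i}"
    by (auto simp: less_Suc_eq)
  have 2: "{i. i < Suc n \<and> Q i} = (if Q n then insert n else id) {i. i < n \<and> Q i}"
    by (auto simp: less_Suc_eq)
  show ?case using Suc unfolding 1 2 by (auto simp: min_def split: if_splits)
qed simp

lemma rround_of_int:
  assumes "x \<in> \<int>" "B \<in> set_pmf (rround x)"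
  shows "of_int B = x"
  using assms by (auto simp: rround_def Ints_def)

context neutral_lp
begin

text \<open>Makes OLC a comparison action with exact budget and no wrong mass. Integrality of
  \<open>\<alpha> * real (length ss)\<close> makes the rounding deterministic.\<close>

lemma olc_actions_budgeted:
  assumes ne: "ss \<noteq> []" and int: "\<alpha> * real (length ss) \<in> \<int>" and def: "olc_defined \<alpha> y st ss"
    and mem: "as \<in> set_pmf (olc_pmf \<alpha> y st ss)"
  shows "budgeted ss as" and "y s a = 0 \<Longrightarrow> count (mset (zip ss as)) (s, a) = 0"
proof -
  obtain B k where B: "real_of_int B = \<alpha> * real (length ss)" and as: "as = olc_actions y st ss B k"
    using mem rround_of_int[OF int] by (auto simp: olc_pmf_def)
  \<comment> \<open>By full support no state is in \<open>Sempty\<close>, so the sum of the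
    \<open>k s\<close> in \<open>olc_actions\<close> is 0.\<close>
  have E: "\<not> Sempty y s" for s using full[of s] by (auto simp: Sempty_def mu_of_def)
  then have "Collect (Sempty y) = {}" by auto
  then have K: "sum k (Collect (Sempty y)) = 0" for k :: "'s \<Rightarrow> int" by (simp only: sum.empty)
  define m where "m = B - int (card {j. j < length ss \<and> Splus y (ss ! j)})"
  have len: "length as = length ss" by (simp add: as olc_actions_def)
  have nth: "as ! i = (if Splus y (ss ! i) then True else if Sminus y (ss ! i) then False
      else int (card {j. j < i \<and> ss ! j = st}) < m)" if "i < length ss" for i
    using that E by (simp add: as olc_actions_def m_def K)
  have cnt: "count (mset (zip ss as)) (s, a) = card {i. i < length ss \<and> ss ! i = s \<and> as ! i = a}" for s a
    by (simp add: count_mset_conv_card len cong: conj_cong)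
  show zero: "count (mset (zip ss as)) (s, a) = 0" if "y s a = 0" for s a
  proof -
    have "s \<noteq> st" using that st_pos by (cases a) auto
    then have "as ! i = (\<not> a)" if "i < length ss" "ss ! i = s" for i
      using that nth[OF that(1)] inactive_or_active[of s] \<open>y s a = 0\<close>
      by (cases a) (auto simp: Splus_def Sminus_def)
    then show ?thesis by (auto simp: cnt)
  qed
  have pib: "pibar y True s = of_bool (Splus y s)" if "s \<noteq> st" for s
    using inactive_or_active[OF that] by (auto simp: pibar_def mu_of_def Splus_def)
  define z where "z s = real (count (mset ss) s)" for s
  have cz: "real (count_st ss s) = z s" for s
    by (simp add: z_def count_st_def count_mset_conv_card)
  define Sp where "Sp = (\<Sum>s\<in>UNIV - {st}. pibar y True s * z s)"
  have nSp: "\<not> Splus y st" using st_pos by (simp add: Splus_def)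
  have Sp: "real (card {j. j < length ss \<and> Splus y (ss ! j)}) = Sp"
  proof -
    have "real (card {j. j < length ss \<and> Splus y (ss ! j)}) = (\<Sum>s\<leftarrow>ss. of_bool (Splus y s))"
      unfolding length_filter_conv_card[symmetric] by (induction ss) auto
    also have "\<dots> = (\<Sum>s\<in>UNIV. z s * of_bool (Splus y s))"
      by (simp add: sum_list_eq_sum_count z_def)
    also have "\<dots> = Sp" unfolding Sp_def using nSp
      by (subst sum.remove[of UNIV st]) (auto simp: pib intro!: sum.cong)
    finally show ?thesis .
  qed
  have sz: "(\<Sum>s\<in>UNIV. z s) = real (length ss)"
    using sum_list_eq_sum_count[of "\<lambda>_. 1" ss] by (simp add: z_def sum_list_triv)
  have "(\<Sum>s\<in>UNIV - {st}. pibar y False s * z s) = (\<Sum>s\<in>UNIV - {st}. z s) - Sp"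
    by (simp add: Sp_def pibar_False left_diff_distrib sum_subtractf)
  also have "(\<Sum>s\<in>UNIV - {st}. z s) = real (length ss) - z st"
    using sz by (simp add: sum.remove[of UNIV st])
  finally have SF: "(\<Sum>s\<in>UNIV - {st}. pibar y False s * z s) = real (length ss) - z st - Sp" .
  have rm: "real_of_int m = \<alpha> * real (length ss) - Sp"
    by (simp add: m_def B Sp)
  \<comment> \<open>The two conditions of \<open>olc_defined\<close> place the remaining budget
    \<open>m\<close> between 0 and the number of arms in \<open>st\<close>.\<close>
  have "0 \<le> real_of_int m" "real_of_int m \<le> z st"
    using def unfolding olc_defined_def cz SF rm Sp_def[symmetric] left_diff_distrib by simp_all
  then have m: "0 \<le> m" "m \<le> int (count (mset ss) st)" by (simp_all add: z_def)
  have "count (mset (zip ss as)) (st, True) = card {i. i < length ss \<and> ss ! i = st \<and> int (card {j. j < i \<and> ss ! j = st}) < m}"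
    unfolding cnt using st_pos nth by (intro arg_cong[of _ _ card]) (auto simp: Splus_def Sminus_def)
  also have "\<dots> = nat m"
    using m unfolding card_first_occurrences by (simp add: count_mset_conv_card[symmetric])
  finally have cst: "real (count (mset (zip ss as)) (st, True)) = real_of_int m" using m by simp
  have other: "real (count (mset (zip ss as)) (s, True)) = pibar y True s * z s" if "s \<noteq> st" for s
  proof -
    define cc where "cc a = count (mset (zip ss as)) (s, a)" for a
    have "y s a = 0 \<Longrightarrow> cc a = 0" for a unfolding cc_def by (rule zero)
    moreover have "cc False + cc True = count (mset ss) s"
      unfolding cc_def by (rule count_mset_zip_sum[OF len[symmetric]])
    ultimately have "real (cc True) = pibar y True s * z s"
      using inactive_or_active[OF that] pib[OF that] by (auto simp: z_def Splus_def)
    then show ?thesis by (simp add: cc_def)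
  qed
  have "real (card {i. i < length ss \<and> as ! i}) = (\<Sum>s\<in>UNIV. real (count (mset (zip ss as)) (s, True)))"
    unfolding sum_count_True[OF len[symmetric], symmetric] by simp
  also have "\<dots> = real_of_int m + Sp"
    by (subst sum.remove[of UNIV st]) (auto simp: cst other Sp_def)
  finally show "budgeted ss as" using ne len by (simp add: budgeted_def rm)
qed

text \<open>Away from \<open>st\<close> the mismatch is the wrong mass itself. In \<open>st\<close>
  the state counts agree, and equal budgets force the surplus of active arms there to balance the
  other states, so its mismatch is at most the total elsewhere; hence the factor 2.\<close>

lemma mset_zip_diff_le_wrong:
  assumes b: "budgeted ss as" and b': "budgeted ss as'"
    and zero: "\<And>s a. y s a = 0 \<Longrightarrow> count (mset (zip ss as')) (s, a) = 0"
  shows "real (size (mset (zip ss as) - mset (zip ss as'))) \<le> 2 * real (length ss) * wrong ss as"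
proof -
  define N where "N = real (length ss)"
  define M where "M s a = count (mset (zip ss as)) (s, a)" for s a
  define M' where "M' s a = count (mset (zip ss as')) (s, a)" for s a
  define off where "off s = (\<Sum>a\<in>UNIV. if y s a = 0 then sa_freq ss as s a else 0)" for s
  have len: "length ss = length as" "length ss = length as'" "N > 0"
    using b b' by (auto simp: budgeted_def N_def)
  have off0: "0 \<le> off s" for s unfolding off_def by (rule off_term_nonneg)
  have w: "wrong ss as = (\<Sum>s\<in>UNIV. off s)" by (simp add: off_mass_def off_def)
  have marg: "M s False + M s True = M' s False + M' s True" for s
    unfolding M_def M'_def count_mset_zip_sum[OF len(1)] count_mset_zip_sum[OF len(2)] ..
  have offs: "real (M s False - M' s False) + real (M s True - M' s True) = N * off s \<and>
      \<bar>real (M' s True) - real (M s True)\<bar> = N * off s" if "s \<noteq> st" for s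
  proof -
    have "N * off s = (if y s False = 0 then real (M s False) else 0) + (if y s True = 0 then real (M s True) else 0)"
      using len(3) by (simp add: off_def UNIV_bool sa_freq_def N_def[symmetric] M_def[symmetric] distrib_left)
    moreover have "y s a = 0 \<Longrightarrow> M' s a = 0" for a unfolding M'_def by (rule zero)
    ultimately show ?thesis using inactive_or_active[OF that] marg[of s] by auto
  qed
  have "(\<Sum>s\<in>UNIV. real (M s True)) = (\<Sum>s\<in>UNIV. real (M' s True))"
    using b b' unfolding M_def M'_def of_nat_sum[symmetric] sum_count_True[OF len(1)] sum_count_True[OF len(2)]
    by (simp add: budgeted_def)
  then have "real (M st True) - real (M' st True) = (\<Sum>s\<in>UNIV - {st}. real (M' s True) - real (M s True))"
    by (simp add: sum.remove[of UNIV st] sum_subtractf)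
  then have "\<bar>real (M st True) - real (M' st True)\<bar> \<le> (\<Sum>s\<in>UNIV - {st}. \<bar>real (M' s True) - real (M s True)\<bar>)"
    by simp
  also have "\<dots> = (\<Sum>s\<in>UNIV - {st}. N * off s)" using offs by (intro sum.cong) auto
  finally have st: "real (M st False - M' st False) + real (M st True - M' st True) \<le> (\<Sum>s\<in>UNIV - {st}. N * off s)"
    using marg[of st] by linarith
  have "real (size (mset (zip ss as) - mset (zip ss as')))
      = (\<Sum>z\<in>UNIV. real (count (mset (zip ss as) - mset (zip ss as')) z))"
  proof -
    obtain us where "mset us = mset (zip ss as) - mset (zip ss as')" by (metis ex_mset)
    then show ?thesis using sum_list_eq_sum_count[of "\<lambda>_. 1" us]
      by (simp add: sum_list_triv flip: size_mset)
  qed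
  also have "\<dots> = (\<Sum>s\<in>UNIV. real (M s False - M' s False) + real (M s True - M' s True))"
    using sum_UNIV_pair[of "\<lambda>s a. real (M s a - M' s a)"]
    by (simp add: UNIV_bool M_def M'_def)
  also have "\<dots> \<le> (\<Sum>s\<in>UNIV - {st}. N * off s) + (\<Sum>s\<in>UNIV - {st}. N * off s)"
    using st by (subst sum.remove[of UNIV st]) (auto simp: offs)
  also have "(\<Sum>s\<in>UNIV - {st}. N * off s) \<le> (\<Sum>s\<in>UNIV. N * off s)"
    using len off0 by (intro sum_mono2) auto
  finally show ?thesis by (simp add: w N_def sum_distrib_left mult.assoc)
qed

text \<open>The centring of the deviation depends on the current states alone, so one offset
  \<open>c\<close> serves all action vectors. This is why they are quantified inside the
  conclusion.\<close>

lemma expect_abs_step_dev: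
  assumes b: "budgeted ss as"
  obtains c where "\<And>as. budgeted ss as \<Longrightarrow> expect (next_states P ss as) (\<lambda>xs. \<bar>\<Sum>t\<in>UNIV. step_dev ss xs t * \<xi> t\<bar>)
       = abs_dev P \<xi> (zip ss as) c / real (length ss)"
proof -
  define N where "N = real (length ss)"
  define k where "k = (\<Sum>t\<in>UNIV. (\<mu> t + (\<Sum>s\<in>UNIV. (X_of ss s - \<mu> s) * \<Phi> s t)) * \<xi> t)"
  have N: "N > 0" using b by (simp add: N_def budgeted_def)
  have "expect (next_states P ss as) (\<lambda>xs. \<bar>\<Sum>t\<in>UNIV. step_dev ss xs t * \<xi> t\<bar>)
       = abs_dev P \<xi> (zip ss as) (- N * k) / N" if "budgeted ss as" for as
  proof -
    have len: "length ss = length as" using that by (simp add: budgeted_def)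
    have "(\<Sum>t\<in>UNIV. step_dev ss xs t * \<xi> t) = (- N * k + sum_list (map \<xi> xs)) / N"
      if "xs \<in> set_pmf (next_states P ss as)" for xs
    proof -
      have lx: "real (length xs) = N" using next_states_support[OF len, of P] that by (auto simp: N_def)
      have "(\<Sum>t\<in>UNIV. step_dev ss xs t * \<xi> t) = (\<Sum>t\<in>UNIV. X_of xs t * \<xi> t) - k"
        by (simp add: step_dev_def k_def sum_subtractf[symmetric] algebra_simps)
      also have "(\<Sum>t\<in>UNIV. X_of xs t * \<xi> t) = sum_list (map \<xi> xs) / N"
        by (simp add: X_of_eq_count lx sum_list_eq_sum_count sum_divide_distrib)
      finally show ?thesis using N by (simp add: field_simps)
    qed
    then have "expect (next_states P ss as) (\<lambda>xs. \<bar>\<Sum>t\<in>UNIV. step_dev ss xs t * \<xi> t\<bar>)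
        = expect (next_states P ss as) (\<lambda>xs. \<bar>- N * k + sum_list (map \<xi> xs)\<bar> / N)"
      using N by (intro expect_cong) simp
    then show ?thesis by (simp add: abs_dev_next_states[OF len, symmetric])
  qed
  then show thesis using that[of "- N * k"] by (simp add: N_def)
qed

text \<open>The 4 is the product of the factors 2 in \<open>abs_dev_mset_diff\<close> and
  \<open>mset_zip_diff_le_wrong\<close>; their N cancels against the normalization of X.\<close>

lemma noise_transfer:
  assumes b: "budgeted ss as" and b': "budgeted ss as'"
    and zero: "\<And>s a. y s a = 0 \<Longrightarrow> count (mset (zip ss as')) (s, a) = 0"
    and xi: "\<And>s. \<bar>\<xi> s\<bar> \<le> 1"
  shows "expect (next_states P ss as') (\<lambda>xs. \<bar>\<Sum>t\<in>UNIV. step_dev ss xs t * \<xi> t\<bar>) - 4 * wrong ss as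
      \<le> expect (next_states P ss as) (\<lambda>xs. \<bar>\<Sum>t\<in>UNIV. step_dev ss xs t * \<xi> t\<bar>)"
proof -
  define N where "N = real (length ss)"
  have N: "N > 0" using b by (simp add: N_def budgeted_def)
  obtain c where c: "\<And>as. budgeted ss as \<Longrightarrow> expect (next_states P ss as) (\<lambda>xs. \<bar>\<Sum>t\<in>UNIV. step_dev ss xs t * \<xi> t\<bar>)
       = abs_dev P \<xi> (zip ss as) c / N"
    using expect_abs_step_dev[OF b] unfolding N_def by blast
  have "\<bar>abs_dev P \<xi> (zip ss as) c - abs_dev P \<xi> (zip ss as') c\<bar>
      \<le> 2 * 1 * real (size (mset (zip ss as) - mset (zip ss as')))"
    by (rule abs_dev_mset_diff[OF xi]) (use b b' in \<open>simp add: budgeted_def\<close>)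
  also have "\<dots> \<le> 2 * (2 * N * wrong ss as)"
    using mset_zip_diff_le_wrong[OF b b' zero] by (simp add: N_def)
  finally have "abs_dev P \<xi> (zip ss as') c - abs_dev P \<xi> (zip ss as) c \<le> 4 * wrong ss as * N"
    by (simp add: abs_le_iff mult_ac)
  then have "(abs_dev P \<xi> (zip ss as') c - abs_dev P \<xi> (zip ss as) c) / N \<le> 4 * wrong ss as"
    using N by (simp add: divide_le_eq)
  then show ?thesis by (simp add: c[OF b] c[OF b'] diff_divide_distrib)
qed

end

section \<open>Time averages along a run\<close>

text \<open>Serves moduli \<open>l\<close> on either side of 1: contraction and expansion both leave
  the factor \<open>\<bar>1 - l\<bar>\<close> after telescoping, so a bound results unless the
  eigenvalue lies on the unit circle.\<close>

lemma telescoped_recursion: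
  fixes a b :: "nat \<Rightarrow> real"
  assumes "\<And>t. 0 \<le> a t \<and> a t \<le> B" "\<And>t. \<bar>a (Suc t) - l * a t\<bar> \<le> b t"
  shows "\<bar>1 - l\<bar> * (\<Sum>t<T. a t) \<le> B + (\<Sum>t<T. b t)"
proof -
  have "(\<Sum>t<T. a (Suc t) - l * a t) = (\<Sum>t<T. (a (Suc t) - a t) + (1 - l) * a t)"
    by (intro sum.cong) (auto simp: algebra_simps)
  also have "\<dots> = (a T - a 0) + (1 - l) * (\<Sum>t<T. a t)"
    unfolding sum.distrib sum_lessThan_telescope sum_distrib_left ..
  finally have eq: "(1 - l) * (\<Sum>t<T. a t) = (\<Sum>t<T. a (Suc t) - l * a t) - (a T - a 0)" by simp
  have "\<bar>\<Sum>t<T. a (Suc t) - l * a t\<bar> \<le> (\<Sum>t<T. b t)"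
    by (intro order_trans[OF sum_abs] sum_mono assms(2))
  moreover have "\<bar>a T - a 0\<bar> \<le> B" using assms(1)[of T] assms(1)[of 0] by linarith
  ultimately have "\<bar>(1 - l) * (\<Sum>t<T. a t)\<bar> \<le> B + (\<Sum>t<T. b t)" unfolding eq by linarith
  then show ?thesis using assms(1) by (simp add: abs_mult sum_nonneg)
qed

context neutral_lp
begin

text \<open>Reduces a policy to the laws of the current state-action pair. The one-step bounds
  condition on that pair alone, so the history can be forgotten once consecutive laws fit together
  through \<open>next_states\<close>.\<close>

definition run :: "nat \<Rightarrow> (nat \<Rightarrow> ('s list \<times> bool list) pmf) \<Rightarrow> bool" where
  "run N J \<longleftrightarrow> (\<forall>t. (\<forall>z\<in>set_pmf (J t). length (fst z) = N \<and> budgeted (fst z) (snd z)) \<and>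
     map_pmf fst (J (Suc t)) = bind_pmf (J t) (\<lambda>z. next_states P (fst z) (snd z)))"

lemma runD:
  assumes "run N J" "z \<in> set_pmf (J t)"
  shows "length (fst z) = N" "length (snd z) = N" "budgeted (fst z) (snd z)" "N > 0"
  using assms by (auto simp: run_def budgeted_def)

lemma run_finite:
  assumes "run N J"
  shows "finite (set_pmf (J t))"
proof (rule finite_subset)
  show "set_pmf (J t) \<subseteq> {ss. length ss = N} \<times> {as. length as = N}"
    using runD[OF assms] by (auto simp: mem_Times_iff)
  show "finite ({ss :: 's list. length ss = N} \<times> {as :: bool list. length as = N})"
    using finite_lists_length_eq[of "UNIV :: 's set" N] finite_lists_length_eq[of "UNIV :: bool set" N]
    by simp
qed

lemma run_pos: "run N J \<Longrightarrow> N > 0"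
  using runD(4) some_in_eq[of "set_pmf (J 0)"] set_pmf_not_empty[of "J 0"] by auto

lemma run_expect_Suc:
  fixes f :: "'s list \<Rightarrow> real"
  assumes "run N J"
  shows "expect (J (Suc t)) (\<lambda>z. f (fst z)) = expect (J t) (\<lambda>z. expect (next_states P (fst z) (snd z)) f)"
proof -
  have "expect (J (Suc t)) (\<lambda>z. f (fst z)) = expect (map_pmf fst (J (Suc t))) f" by simp
  also have "\<dots> = expect (bind_pmf (J t) (\<lambda>z. next_states P (fst z) (snd z))) f"
    using assms by (simp add: run_def)
  also have "\<dots> = expect (J t) (\<lambda>z. expect (next_states P (fst z) (snd z)) f)"
    using runD[OF assms] by (intro expect_bind run_finite[OF assms] next_states_finite) auto
  finally show ?thesis .
qed

lemma run_expect_add: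
  fixes f g :: "'s list \<times> bool list \<Rightarrow> real"
  assumes "run N J"
  shows "expect (J t) (\<lambda>z. f z + g z) = expect (J t) f + expect (J t) g"
  by (intro Bochner_Integration.integral_add integrable_measure_pmf_finite run_finite[OF assms])

abbreviation mean_abs :: "(nat \<Rightarrow> ('s list \<times> bool list) pmf) \<Rightarrow> complex^'s \<Rightarrow> nat \<Rightarrow> real" where
  "mean_abs J w t \<equiv> expect (J t) (\<lambda>z. cmod (proj w (fst z)))"

abbreviation mean_wrong :: "(nat \<Rightarrow> ('s list \<times> bool list) pmf) \<Rightarrow> nat \<Rightarrow> real" where
  "mean_wrong J t \<equiv> expect (J t) (\<lambda>z. wrong (fst z) (snd z))"

lemma mean_abs_bounds: "run N J \<Longrightarrow> 0 \<le> mean_abs J w t \<and> mean_abs J w t \<le> wt w"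
  by (rule expect_bounds) (auto simp: run_finite proj_bound)

lemma mean_wrong_nonneg: "0 \<le> mean_wrong J t"
  by (simp add: wrong_nonneg)

text \<open>If \<open>w\<close> is not an eigenvector, the remainder Phi w - l w acts as a forcing
  term, to be bounded before \<open>w\<close> itself.\<close>

lemma mean_abs_step:
  assumes run: "run N J"
  shows "\<bar>mean_abs J w (Suc t) - cmod l * mean_abs J w t\<bar>
     \<le> mean_abs J (Phi_c *v w - l *s w) t + wt w * (1 / sqrt (real N) + 2 * mean_wrong J t)"
proof -
  note fin = run_finite[OF run, of t]
  define v where "v = Phi_c *v w - l *s w"
  define e where "e z = expect (next_states P (fst z) (snd z)) (\<lambda>xs. cmod (proj w xs))" for z
  define R where "R z = cmod (proj v (fst z)) + wt w * (1 / sqrt (real N) + 2 * wrong (fst z) (snd z))" for z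
  have pt: "\<bar>e z - cmod l * cmod (proj w (fst z))\<bar> \<le> R z" if z: "z \<in> set_pmf (J t)" for z
  proof -
    define n where "n = next_states P (fst z) (snd z)"
    have fn: "finite (set_pmf n)" unfolding n_def
      using runD[OF run z] by (intro next_states_finite) simp
    note int = integrable_measure_pmf_finite[OF fn]
    have pw: "\<bar>cmod (proj w xs) - cmod l * cmod (proj w (fst z))\<bar>
        \<le> cmod (proj w xs - proj (Phi_c *v w) (fst z)) + cmod (proj v (fst z))" for xs
    proof -
      have "\<bar>cmod (proj w xs) - cmod (l * proj w (fst z))\<bar> \<le> cmod (proj w xs - l * proj w (fst z))"
        by (rule norm_triangle_ineq3)
      also have "proj w xs - l * proj w (fst z) = (proj w xs - proj (Phi_c *v w) (fst z)) + proj v (fst z)"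
        by (simp add: v_def proj_linear)
      also have "cmod \<dots> \<le> cmod (proj w xs - proj (Phi_c *v w) (fst z)) + cmod (proj v (fst z))"
        by (rule norm_triangle_ineq)
      finally show ?thesis by (simp add: norm_mult)
    qed
    have "\<bar>e z - cmod l * cmod (proj w (fst z))\<bar> = \<bar>expect n (\<lambda>xs. cmod (proj w xs) - cmod l * cmod (proj w (fst z)))\<bar>"
      unfolding e_def n_def[symmetric] by (subst Bochner_Integration.integral_diff) (auto intro: int)
    also have "\<dots> \<le> expect n (\<lambda>xs. \<bar>cmod (proj w xs) - cmod l * cmod (proj w (fst z))\<bar>)"
      by (rule integral_abs_bound)
    also have "\<dots> \<le> expect n (\<lambda>xs. cmod (proj w xs - proj (Phi_c *v w) (fst z)) + cmod (proj v (fst z)))"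
      by (rule expect_mono[OF fn pw])
    also have "\<dots> = expect n (\<lambda>xs. cmod (proj w xs - proj (Phi_c *v w) (fst z))) + cmod (proj v (fst z))"
      by (subst Bochner_Integration.integral_add) (auto intro: int)
    also have "\<dots> \<le> R z"
      using expect_proj_step(1)[OF runD(3)[OF run z], of w] runD(1)[OF run z] by (simp add: R_def n_def)
    finally show ?thesis .
  qed
  have "mean_abs J w (Suc t) - cmod l * mean_abs J w t = expect (J t) (\<lambda>z. e z - cmod l * cmod (proj w (fst z)))"
    unfolding run_expect_Suc[OF run, where f = "\<lambda>xs. cmod (proj w xs)"] e_def
    by (subst Bochner_Integration.integral_diff) (auto intro: integrable_measure_pmf_finite[OF fin])
  also have "\<bar>\<dots>\<bar> \<le> expect (J t) (\<lambda>z. \<bar>e z - cmod l * cmod (proj w (fst z))\<bar>)"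
    by (rule integral_abs_bound)
  also have "\<dots> \<le> expect (J t) R"
    by (rule expect_mono[OF fin pt])
  also have "\<dots> = mean_abs J v t + expect (J t) (\<lambda>z. wt w * (1 / sqrt (real N) + 2 * wrong (fst z) (snd z)))"
    unfolding R_def by (rule run_expect_add[OF run])
  also have "expect (J t) (\<lambda>z. wt w * (1 / sqrt (real N) + 2 * wrong (fst z) (snd z)))
      = wt w * (1 / sqrt (real N) + 2 * mean_wrong J t)"
  proof -
    have "expect (J t) (\<lambda>z. 1 / sqrt (real N) + 2 * wrong (fst z) (snd z))
        = expect (J t) (\<lambda>z. 1 / sqrt (real N)) + expect (J t) (\<lambda>z. 2 * wrong (fst z) (snd z))"
      by (rule run_expect_add[OF run])
    then show ?thesis by simp
  qed
  finally show ?thesis by (simp add: v_def)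
qed

lemma mean_abs_unstable_step:
  assumes run: "run N J" and w: "Phi_c *v w = l *s w"
  shows "cmod l * mean_abs J w t \<le> mean_abs J w (Suc t) + wt w * 2 * mean_wrong J t"
proof -
  note fin = run_finite[OF run, of t]
  have "cmod l * mean_abs J w t = expect (J t) (\<lambda>z. cmod l * cmod (proj w (fst z)))" by simp
  also have "\<dots> \<le> expect (J t) (\<lambda>z. expect (next_states P (fst z) (snd z)) (\<lambda>xs. cmod (proj w xs)) + wt w * 2 * wrong (fst z) (snd z))"
    using expect_proj_step(2)[OF runD(3)[OF run], of _ t w]
    by (intro expect_mono[OF fin]) (simp add: w proj_linear norm_mult)
  finally show ?thesis
    by (simp add: run_expect_add[OF run] run_expect_Suc[OF run, where f = "\<lambda>xs. cmod (proj w xs)"])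
qed

text \<open>\<open>C\<close> may depend on \<open>w\<close> but not on the number of arms, the run
  or the horizon. The 1 absorbs boundary terms of telescoping.\<close>

definition controlled :: "(complex^'s) set" where
  "controlled = {w. \<exists>C. \<forall>N J T. run N J \<longrightarrow>
     (\<Sum>t<T. mean_abs J w t) \<le> C * (1 + real T / sqrt (real N) + (\<Sum>t<T. mean_wrong J t))}"

lemma controlled_peel:
  assumes v: "Phi_c *v w - l *s w \<in> controlled" and l: "cmod l \<noteq> 1"
  shows "w \<in> controlled"
proof -
  obtain C where C: "\<And>N J T. run N J \<Longrightarrow> (\<Sum>t<T. mean_abs J (Phi_c *v w - l *s w) t)
      \<le> C * (1 + real T / sqrt (real N) + (\<Sum>t<T. mean_wrong J t))"
    using v by (auto simp: controlled_def)
  have "(\<Sum>t<T. mean_abs J w t) \<le> (3 * wt w + C) / \<bar>1 - cmod l\<bar> * (1 + real T / sqrt (real N) + (\<Sum>t<T. mean_wrong J t))"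
    if run: "run N J" for N J T
  proof -
    define Q where "Q = 1 + real T / sqrt (real N) + (\<Sum>t<T. mean_wrong J t)"
    have W: "0 \<le> (\<Sum>t<T. mean_wrong J t)" "0 \<le> real T / sqrt (real N)"
      by (simp_all add: sum_nonneg mean_wrong_nonneg)
    have "\<bar>1 - cmod l\<bar> * (\<Sum>t<T. mean_abs J w t)
      \<le> wt w + (\<Sum>t<T. mean_abs J (Phi_c *v w - l *s w) t + wt w * (1 / sqrt (real N) + 2 * mean_wrong J t))"
      by (rule telescoped_recursion[where a = "mean_abs J w"])
        (use mean_abs_bounds[OF run] mean_abs_step[OF run] in auto)
    also have "\<dots> = wt w * (1 + real T / sqrt (real N) + 2 * (\<Sum>t<T. mean_wrong J t)) + (\<Sum>t<T. mean_abs J (Phi_c *v w - l *s w) t)"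
      by (simp add: sum.distrib sum_distrib_left algebra_simps)
    also have "\<dots> \<le> wt w * (3 * Q) + C * Q"
    proof (intro add_mono mult_left_mono wt_nonneg)
      show "1 + real T / sqrt (real N) + 2 * (\<Sum>t<T. mean_wrong J t) \<le> 3 * Q"
        using W unfolding Q_def by argo
    qed (use C[OF run, of T] in \<open>simp add: Q_def\<close>)
    also have "\<dots> = (3 * wt w + C) * Q" by (simp add: algebra_simps)
    finally have "(\<Sum>t<T. mean_abs J w t) \<le> (3 * wt w + C) * Q / \<bar>1 - cmod l\<bar>"
      using l by (simp add: pos_le_divide_eq mult.commute)
    then show ?thesis unfolding Q_def by simp
  qed
  then show ?thesis unfolding controlled_def by blast
qed

lemma all_controlled:
  assumes hyp: "\<And>z. eigenvalue \<Phi> z \<Longrightarrow> cmod z \<noteq> 1"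
  shows "w \<in> controlled"
proof (rule eigenvalue_peeling[where A = Phi_c])
  show "0 \<in> controlled"
    unfolding controlled_def by (auto simp: proj_linear intro!: exI[of _ 0])
  fix l u w assume "Phi_c *v u = l *s u" "u \<noteq> 0" "Phi_c *v w - l *s w \<in> controlled"
  moreover from this have "eigenvalue \<Phi> l" by (auto simp: eigenvalue_iff Phi_c_def)
  ultimately show "w \<in> controlled" using hyp controlled_peel by blast
qed

definition l1_dist :: "'s list \<Rightarrow> real" where
  "l1_dist ss = (\<Sum>s\<in>UNIV. \<bar>X_of ss s - \<mu> s\<bar>)"

lemma proj_axis: "cmod (proj (axis s 1) ss) = \<bar>X_of ss s - \<mu> s\<bar>"
proof -
  have "proj (axis s 1) ss = of_real (X_of ss s - \<mu> s)"
    by (simp add: proj_def axis_def if_distrib cong: if_cong)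
  then show ?thesis by (simp only: norm_of_real)
qed

text \<open>Uses the standard basis vectors, whose coordinates are the entries of X - \<mu>. They
  are not eigenvectors in general, which is the reason for controlling every vector.\<close>

lemma mean_l1_dist_bound:
  assumes hyp: "\<And>z. eigenvalue \<Phi> z \<Longrightarrow> cmod z \<noteq> 1"
  obtains C where "C > 0" "\<And>N J T. run N J \<Longrightarrow>
     (\<Sum>t<T. expect (J t) (\<lambda>z. l1_dist (fst z))) \<le> C * (1 + real T / sqrt (real N) + (\<Sum>t<T. mean_wrong J t))"
proof -
  have "\<forall>s. \<exists>C. \<forall>N J T. run N J \<longrightarrow>
     (\<Sum>t<T. mean_abs J (axis s 1) t) \<le> C * (1 + real T / sqrt (real N) + (\<Sum>t<T. mean_wrong J t))"
  proof
    fix s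
    show "\<exists>C. \<forall>N J T. run N J \<longrightarrow>
      (\<Sum>t<T. mean_abs J (axis s 1) t) \<le> C * (1 + real T / sqrt (real N) + (\<Sum>t<T. mean_wrong J t))"
      using all_controlled[OF hyp, of "axis s 1"] unfolding controlled_def by (rule CollectD)
  qed
  from choice[OF this] obtain C where C: "\<And>s N J T. run N J \<Longrightarrow>
     (\<Sum>t<T. mean_abs J (axis s 1) t) \<le> C s * (1 + real T / sqrt (real N) + (\<Sum>t<T. mean_wrong J t))"
    by blast
  have "(\<Sum>t<T. expect (J t) (\<lambda>z. l1_dist (fst z)))
      \<le> (1 + \<bar>\<Sum>s\<in>UNIV. C s\<bar>) * (1 + real T / sqrt (real N) + (\<Sum>t<T. mean_wrong J t))" (is "_ \<le> _ * ?Q")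
    if run: "run N J" for N J T
  proof -
    have Q: "0 \<le> ?Q" by (intro add_nonneg_nonneg sum_nonneg mean_wrong_nonneg) auto
    have "expect (J t) (\<lambda>z. l1_dist (fst z)) = (\<Sum>s\<in>UNIV. mean_abs J (axis s 1) t)" for t
      unfolding l1_dist_def proj_axis
      by (subst Bochner_Integration.integral_sum)
        (auto intro: integrable_measure_pmf_finite[OF run_finite[OF run]])
    then have "(\<Sum>t<T. expect (J t) (\<lambda>z. l1_dist (fst z))) = (\<Sum>s\<in>UNIV. \<Sum>t<T. mean_abs J (axis s 1) t)"
      by (simp only:) (rule sum.swap)
    also have "\<dots> \<le> (\<Sum>s\<in>UNIV. C s) * ?Q"
      unfolding sum_distrib_right by (intro sum_mono C[OF run])
    also have "\<dots> \<le> (1 + \<bar>\<Sum>s\<in>UNIV. C s\<bar>) * ?Q"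
      using Q by (intro mult_right_mono) auto
    finally show ?thesis .
  qed
  with that[of "1 + \<bar>\<Sum>s\<in>UNIV. C s\<bar>"] show thesis by (meson abs_ge_zero add_pos_nonneg zero_less_one)
qed

text \<open>A coordinate that expands in mean and yet stays bounded must be held small by wrong
  actions. In contrast to \<open>controlled\<close> no T / sqrt N appears.\<close>

lemma sum_mean_abs_unstable:
  assumes run: "run N J" and w: "Phi_c *v w = l *s w"
  shows "(cmod l - 1) * (\<Sum>t<T. mean_abs J w t) \<le> wt w * (1 + 2 * (\<Sum>t<T. mean_wrong J t))"
proof -
  have "(\<Sum>t<T. cmod l * mean_abs J w t) \<le> (\<Sum>t<T. mean_abs J w (Suc t) + wt w * 2 * mean_wrong J t)"
    by (intro sum_mono mean_abs_unstable_step[OF run w])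
  also have "\<dots> = (\<Sum>t<T. mean_abs J w (Suc t)) + wt w * 2 * (\<Sum>t<T. mean_wrong J t)"
    by (simp add: sum.distrib sum_distrib_left)
  also have "(\<Sum>t<T. mean_abs J w (Suc t)) = (\<Sum>t<T. mean_abs J w t) + mean_abs J w T - mean_abs J w 0"
    using sum_lessThan_telescope[of "mean_abs J w" T] by (simp add: sum_subtractf)
  finally have "cmod l * (\<Sum>t<T. mean_abs J w t) \<le> (\<Sum>t<T. mean_abs J w t)
      + (mean_abs J w T - mean_abs J w 0) + wt w * 2 * (\<Sum>t<T. mean_wrong J t)"
    by (simp add: sum_distrib_left)
  moreover have "mean_abs J w T - mean_abs J w 0 \<le> wt w"
    using mean_abs_bounds[OF run, where w = w and t = T] mean_abs_bounds[OF run, where w = w and t = 0]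
    by linarith
  ultimately show ?thesis by (simp add: left_diff_distrib distrib_left)
qed

section \<open>Lower bound on wrong actions\<close>

text \<open>The factor \<open>1 - l1_dist ss / \<eta>\<close> replaces the case distinction between
  near and far: it is at most 1 near the optimum and negative outside the radius, where the bound
  becomes trivial. Being linear in the distance, it can be averaged over a run.\<close>

lemma noise_lower_bound:
  assumes b: "budgeted ss as" and int: "\<alpha> * real (length ss) \<in> \<int>" and \<eta>: "\<eta> > 0" and K: "K > 0"
    and noise: "l1_dist ss \<le> \<eta> \<Longrightarrow> olc_defined \<alpha> y st ss \<and> (\<forall>as\<in>set_pmf (olc_pmf \<alpha> y st ss).
      K / sqrt (real (length ss)) \<le> expect (next_states P ss as) (\<lambda>xs. \<bar>\<Sum>t\<in>UNIV. step_dev ss xs t * \<xi> t\<bar>))"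
    and xi: "\<And>s. \<bar>\<xi> s\<bar> \<le> 1"
  shows "K / sqrt (real (length ss)) * (1 - l1_dist ss / \<eta>) - 4 * wrong ss as
      \<le> expect (next_states P ss as) (\<lambda>xs. \<bar>\<Sum>t\<in>UNIV. step_dev ss xs t * \<xi> t\<bar>)" (is "?q * _ - _ \<le> ?E as")
proof (cases "l1_dist ss \<le> \<eta>")
  case True
  have ne: "ss \<noteq> []" using b by (simp add: budgeted_def)
  obtain as' where as': "as' \<in> set_pmf (olc_pmf \<alpha> y st ss)" using set_pmf_not_empty by fast
  note olc = olc_actions_budgeted[OF ne int noise[OF True, THEN conjunct1] as']
  have "?q * (1 - l1_dist ss / \<eta>) \<le> ?q * 1"
    using K \<eta> by (intro mult_left_mono) (auto simp: l1_dist_def sum_nonneg)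
  also have "\<dots> \<le> ?E as'" using noise[OF True] as' by simp
  finally show ?thesis using noise_transfer[where \<xi> = \<xi>, OF b olc xi] by linarith
next
  case False
  then have "?q * (1 - l1_dist ss / \<eta>) \<le> 0"
    using K \<eta> by (intro mult_nonneg_nonpos) auto
  moreover have "0 \<le> ?E as" by simp
  ultimately show ?thesis using wrong_nonneg[of ss as] by linarith
qed

text \<open>A left null vector and a right eigenvector of nonzero eigenvalue are orthogonal. The
  noise hypothesis demands this of its directions.\<close>

lemma eigenvector_orthogonal_mu:
  assumes w: "Phi_c *v w = l *s w" and l: "l \<noteq> 0"
  shows "(\<Sum>s\<in>UNIV. of_real (\<mu> s) * w $ s) = 0"
proof -
  have "l * (\<Sum>s\<in>UNIV. of_real (\<mu> s) * w $ s) = (\<Sum>s\<in>UNIV. of_real (\<mu> s) * (l *s w) $ s)"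
    by (simp add: sum_distrib_left mult.left_commute)
  also have "\<dots> = (\<Sum>s\<in>UNIV. \<Sum>t\<in>UNIV. of_real (\<mu> s * \<Phi> s t) * w $ t)"
    unfolding w[symmetric] by (simp add: Phi_c_def matrix_vector_mult_def sum_distrib_left mult.assoc)
  also have "\<dots> = (\<Sum>t\<in>UNIV. of_real (\<Sum>s\<in>UNIV. \<mu> s * \<Phi> s t) * w $ t)"
    by (subst sum.swap) (simp add: sum_distrib_right)
  finally show ?thesis using l by (simp add: mu_Phi)
qed

text \<open>The noise hypothesis takes real unit directions; the direction used is the real part of
  an eigenvector, normalized by this quantity.\<close>

definition re_norm :: "complex^'s \<Rightarrow> real" where
  "re_norm w = sqrt (\<Sum>s\<in>UNIV. (Re (w $ s))\<^sup>2)"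

text \<open>An eigenvector whose real part vanishes is multiplied by the imaginary unit.\<close>

lemma eigenvector_with_re_norm_pos:
  assumes "Phi_c *v w = l *s w" "w \<noteq> 0"
  obtains v where "Phi_c *v v = l *s v" "re_norm v > 0"
proof -
  have pos: "re_norm v > 0" if "Re (v $ s) \<noteq> 0" for v s
    unfolding re_norm_def real_sqrt_gt_0_iff using that by (intro sum_pos2[of _ s]) auto
  obtain s where "w $ s \<noteq> 0" using assms(2) by (auto simp: vec_eq_iff)
  then consider "Re (w $ s) \<noteq> 0" | "Re ((\<i> *s w) $ s) \<noteq> 0" by (auto simp: complex_eq_iff)
  then show thesis
  proof cases
    case 2
    moreover have "Phi_c *v (\<i> *s w) = l *s (\<i> *s w)"
      by (simp add: vector_scalar_commute assms(1) vec.scale_left_commute)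
    ultimately show thesis using that pos by blast
  qed (use that pos assms in blast)
qed

text \<open>The deviation is real, so its component along Re w is the real part of z' - l z, and
  this is at most |z'| + |l| |z| in absolute value.\<close>

lemma unstable_noise_lower_bound:
  assumes b: "budgeted ss as" and int: "\<alpha> * real (length ss) \<in> \<int>" and \<eta>: "\<eta> > 0" and K: "K > 0"
    and noise: "\<And>\<xi>. l1_dist ss \<le> \<eta> \<Longrightarrow> olc_defined \<alpha> y st ss \<and> (\<forall>as\<in>set_pmf (olc_pmf \<alpha> y st ss).
      sqrt (\<Sum>s\<in>UNIV. (\<xi> s)\<^sup>2) = 1 \<longrightarrow> (\<Sum>s\<in>UNIV. \<mu> s * \<xi> s) = 0 \<longrightarrow>
      K / sqrt (real (length ss)) \<le> expect (next_states P ss as) (\<lambda>xs. \<bar>\<Sum>t\<in>UNIV. step_dev ss xs t * \<xi> t\<bar>))"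
    and w: "Phi_c *v w = l *s w" and l: "l \<noteq> 0" and U: "re_norm w > 0"
  shows "re_norm w * (K / sqrt (real (length ss)) * (1 - l1_dist ss / \<eta>) - 4 * wrong ss as)
      \<le> expect (next_states P ss as) (\<lambda>xs. cmod (proj w xs)) + cmod l * cmod (proj w ss)"
proof -
  define U where "U = re_norm w"
  define \<xi> where "\<xi> s = Re (w $ s) / U" for s
  define n where "n = next_states P ss as"
  have U0: "U > 0" using U by (simp add: U_def)
  have fin: "finite (set_pmf n)" unfolding n_def
    using b by (intro next_states_finite) (simp add: budgeted_def)
  have U2: "(\<Sum>s\<in>UNIV. (Re (w $ s))\<^sup>2) = U\<^sup>2" unfolding U_def re_norm_def
    by (simp add: sum_nonneg)
  have sq1: "(\<Sum>s\<in>UNIV. (\<xi> s)\<^sup>2) = 1"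
    using U0 by (simp add: \<xi>_def power_divide sum_divide_distrib[symmetric] U2)
  have orth: "(\<Sum>s\<in>UNIV. \<mu> s * \<xi> s) = 0"
  proof -
    have "Re (\<Sum>s\<in>UNIV. of_real (\<mu> s) * w $ s) = 0" using eigenvector_orthogonal_mu[OF w l] by simp
    then show ?thesis by (simp add: \<xi>_def sum_divide_distrib[symmetric])
  qed
  have xi1: "\<bar>\<xi> s\<bar> \<le> 1" for s
    using member_le_sum[of s UNIV "\<lambda>s. (\<xi> s)\<^sup>2"] by (simp add: sq1 abs_square_le_1)
  have "U * (K / sqrt (real (length ss)) * (1 - l1_dist ss / \<eta>) - 4 * wrong ss as)
      \<le> U * expect n (\<lambda>xs. \<bar>\<Sum>t\<in>UNIV. step_dev ss xs t * \<xi> t\<bar>)"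
    unfolding n_def
    by (rule mult_left_mono[OF noise_lower_bound[OF b int \<eta> K _ xi1]]) (use noise sq1 orth U0 in auto)
  also have "\<dots> = expect n (\<lambda>xs. U * \<bar>\<Sum>t\<in>UNIV. step_dev ss xs t * \<xi> t\<bar>)" by simp
  also have "\<dots> \<le> expect n (\<lambda>xs. cmod (proj w xs) + cmod l * cmod (proj w ss))"
  proof (rule expect_mono[OF fin])
    fix xs
    have "U * (\<Sum>t\<in>UNIV. step_dev ss xs t * \<xi> t) = (\<Sum>t\<in>UNIV. step_dev ss xs t * Re (w $ t))"
      using U0 by (simp add: \<xi>_def sum_distrib_left)
    also have "\<dots> = Re (proj w xs - proj (Phi_c *v w) ss)" unfolding proj_step by simp
    finally have "U * \<bar>\<Sum>t\<in>UNIV. step_dev ss xs t * \<xi> t\<bar> = \<bar>Re (proj w xs - l * proj w ss)\<bar>"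
      using U0 unfolding w proj_linear by (metis abs_mult abs_of_pos)
    also have "\<dots> \<le> cmod (proj w xs - l * proj w ss)" by (rule abs_Re_le_cmod)
    also have "\<dots> \<le> cmod (proj w xs) + cmod (l * proj w ss)" by (rule norm_triangle_ineq4)
    finally show "U * \<bar>\<Sum>t\<in>UNIV. step_dev ss xs t * \<xi> t\<bar> \<le> cmod (proj w xs) + cmod l * cmod (proj w ss)"
      by (simp add: norm_mult)
  qed
  also have "\<dots> = expect n (\<lambda>xs. cmod (proj w xs)) + cmod l * cmod (proj w ss)"
    by (subst Bochner_Integration.integral_add) (auto intro: integrable_measure_pmf_finite[OF fin])
  finally show ?thesis by (simp add: U_def n_def)
qed

lemma mean_wrong_lower_bound:
  assumes unstable: "eigenvalue \<Phi> l" "cmod l > 1" and hyp: "\<And>z. eigenvalue \<Phi> z \<Longrightarrow> cmod z \<noteq> 1"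
    and \<eta>: "\<eta> > 0" and K: "K > 0"
    and noise: "\<And>ss \<xi>. length ss \<ge> N1 \<Longrightarrow> l1_dist ss \<le> \<eta> \<Longrightarrow> olc_defined \<alpha> y st ss \<and> (\<forall>as\<in>set_pmf (olc_pmf \<alpha> y st ss).
      sqrt (\<Sum>s\<in>UNIV. (\<xi> s)\<^sup>2) = 1 \<longrightarrow> (\<Sum>s\<in>UNIV. \<mu> s * \<xi> s) = 0 \<longrightarrow>
      K / sqrt (real (length ss)) \<le> expect (next_states P ss as) (\<lambda>xs. \<bar>\<Sum>t\<in>UNIV. step_dev ss xs t * \<xi> t\<bar>))"
  obtains c N0 where "c > 0" "\<And>N J T. N \<ge> N0 \<Longrightarrow> \<alpha> * real N \<in> \<int> \<Longrightarrow> run N J \<Longrightarrow>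
     c * (real T / sqrt (real N)) \<le> 1 + (\<Sum>t<T. mean_wrong J t)"
proof -
  obtain w where w: "Phi_c *v w = l *s w" and U: "re_norm w > 0"
    using unstable(1) eigenvector_with_re_norm_pos unfolding eigenvalue_iff Phi_c_def by blast
  obtain C where C: "C > 0" "\<And>N J T. run N J \<Longrightarrow> (\<Sum>t<T. expect (J t) (\<lambda>z. l1_dist (fst z)))
      \<le> C * (1 + real T / sqrt (real N) + (\<Sum>t<T. mean_wrong J t))"
    using mean_l1_dist_bound[OF hyp] by blast
  define U where "U = re_norm w"
  \<comment> \<open>\<open>A\<close> collects the upper bound for the summed E|z'| + |l| E|z|: twice
    \<open>wt w / (cmod l - 1)\<close> from \<open>sum_mean_abs_unstable\<close>, and
    \<open>wt w\<close> for the shift from z' to z. \<open>M\<close> adds the losses from noise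
    transfer and from distance.\<close>
  define A where "A = (1 + cmod l) * (2 * wt w / (cmod l - 1)) + wt w"
  define M where "M = A + 4 * U + K * U"
  have U0: "U > 0" using U by (simp add: U_def)
  have A0: "A \<ge> 0" unfolding A_def using unstable(2) wt_nonneg[of w] by simp
  have M0: "M > 0" unfolding M_def using A0 U0 K by (simp add: add_nonneg_pos)
  have "K * U / (2 * M) * (real T / sqrt (real N)) \<le> 1 + (\<Sum>t<T. mean_wrong J t)"
    if N: "N \<ge> max N1 (nat \<lceil>(2 * C / \<eta>)\<^sup>2\<rceil>)" and int: "\<alpha> * real N \<in> \<int>" and run: "run N J" for N J T
  proof -
    define W where "W = (\<Sum>t<T. mean_wrong J t)"
    define S where "S = (\<Sum>t<T. mean_abs J w t)"
    define D where "D = (\<Sum>t<T. expect (J t) (\<lambda>z. l1_dist (fst z)))"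
    define q where "q = sqrt (real N)"
    define \<tau> where "\<tau> = real T / q"
    have W0: "W \<ge> 0" unfolding W_def by (intro sum_nonneg mean_wrong_nonneg)
    have q0: "q > 0" using run_pos[OF run] by (simp add: q_def)
    have \<tau>0: "\<tau> \<ge> 0" using q0 by (simp add: \<tau>_def)
    \<comment> \<open>This threshold on N makes the average distance, measured in units of
      \<open>\<eta>\<close>, cost at most half of the noise term \<open>K * \<tau>\<close>; the
      other half survives.\<close>
    have "(2 * C / \<eta>)\<^sup>2 \<le> real N" using N by linarith
    then have "2 * C / \<eta> \<le> q" unfolding q_def by (rule real_le_rsqrt)
    then have "2 * C / \<eta> / q \<le> 1" using q0 by (simp only: pos_divide_le_eq mult_1)
    moreover have "C / \<eta> / q = (2 * C / \<eta> / q) / 2" by simp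
    ultimately have qC: "C / \<eta> / q \<le> 1 / 2" by linarith
    have DC: "D \<le> C * (1 + \<tau> + W)" using C(2)[OF run, of T] by (simp add: D_def W_def \<tau>_def q_def)
    have "(cmod l - 1) * S \<le> wt w * (1 + 2 * W)"
      using sum_mean_abs_unstable[OF run w, of T] by (simp add: S_def W_def)
    also have "\<dots> \<le> wt w * (2 * (1 + W))" using W0 by (intro mult_left_mono wt_nonneg) simp
    finally have S_le: "S \<le> 2 * wt w / (cmod l - 1) * (1 + W)"
      using unstable(2) by (simp add: field_simps)
    have step: "U * (K / q - K / (q * \<eta>) * expect (J t) (\<lambda>z. l1_dist (fst z)) - 4 * mean_wrong J t)
        \<le> mean_abs J w (Suc t) + cmod l * mean_abs J w t" for t
    proof -
      note fin = run_finite[OF run, of t]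
      have "expect (J t) (\<lambda>z. U * (K / q * (1 - l1_dist (fst z) / \<eta>) - 4 * wrong (fst z) (snd z)))
          \<le> expect (J t) (\<lambda>z. expect (next_states P (fst z) (snd z)) (\<lambda>xs. cmod (proj w xs)) + cmod l * cmod (proj w (fst z)))"
      proof (rule expect_mono[OF fin])
        fix z assume z: "z \<in> set_pmf (J t)"
        have len: "length (fst z) = N" by (rule runD(1)[OF run z])
        show "U * (K / q * (1 - l1_dist (fst z) / \<eta>) - 4 * wrong (fst z) (snd z))
            \<le> expect (next_states P (fst z) (snd z)) (\<lambda>xs. cmod (proj w xs)) + cmod l * cmod (proj w (fst z))"
          using unstable_noise_lower_bound[OF runD(3)[OF run z] _ \<eta> K noise w _ U] int N unstable(2) len
          by (force simp: U_def q_def)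
      qed
      also have "\<dots> = mean_abs J w (Suc t) + cmod l * mean_abs J w t"
        unfolding run_expect_add[OF run] run_expect_Suc[OF run, where f = "\<lambda>xs. cmod (proj w xs)"] by simp
      also have "expect (J t) (\<lambda>z. U * (K / q * (1 - l1_dist (fst z) / \<eta>) - 4 * wrong (fst z) (snd z)))
          = U * expect (J t) (\<lambda>z. (K / q + - (K / (q * \<eta>)) * l1_dist (fst z)) + - 4 * wrong (fst z) (snd z))"
        by (subst integral_mult_right_zero[symmetric], intro expect_cong) (simp add: algebra_simps)
      also have "\<dots> = U * (K / q - K / (q * \<eta>) * expect (J t) (\<lambda>z. l1_dist (fst z)) - 4 * mean_wrong J t)"
        unfolding run_expect_add[OF run] by simp
      finally show ?thesis .
    qed
    have "U * (K * \<tau> - K / (q * \<eta>) * D - 4 * W)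
        = (\<Sum>t<T. U * (K / q - K / (q * \<eta>) * expect (J t) (\<lambda>z. l1_dist (fst z)) - 4 * mean_wrong J t))"
      by (simp only: D_def W_def \<tau>_def sum_distrib_left[symmetric] sum_subtractf sum_constant card_lessThan) simp
    also have "\<dots> \<le> (\<Sum>t<T. mean_abs J w (Suc t) + cmod l * mean_abs J w t)"
      by (intro sum_mono step)
    also have "\<dots> = (1 + cmod l) * S + (mean_abs J w T - mean_abs J w 0)"
      using sum_lessThan_telescope[of "mean_abs J w" T]
      by (simp add: sum.distrib sum_subtractf sum_distrib_left[symmetric] S_def distrib_right)
    also have "\<dots> \<le> (1 + cmod l) * (2 * wt w / (cmod l - 1) * (1 + W)) + wt w * (1 + W)"
    proof (rule add_mono)
      show "(1 + cmod l) * S \<le> (1 + cmod l) * (2 * wt w / (cmod l - 1) * (1 + W))"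
        by (intro mult_left_mono S_le) simp
      have "mean_abs J w T - mean_abs J w 0 \<le> wt w * 1"
        using mean_abs_bounds[OF run, where w = w and t = T] mean_abs_bounds[OF run, where w = w and t = 0]
        by linarith
      also have "\<dots> \<le> wt w * (1 + W)" using W0 by (intro mult_left_mono wt_nonneg) simp
      finally show "mean_abs J w T - mean_abs J w 0 \<le> wt w * (1 + W)" .
    qed
    also have "\<dots> = A * (1 + W)" by (simp add: A_def algebra_simps)
    finally have main: "U * (K * \<tau> - K / (q * \<eta>) * D - 4 * W) \<le> A * (1 + W)" .
    have "K / (q * \<eta>) * D \<le> K / (q * \<eta>) * (C * (1 + \<tau> + W))"
      using K q0 \<eta> DC by (intro mult_left_mono) auto
    also have "\<dots> = K * ((C / \<eta> / q) * (1 + \<tau> + W))" by (simp add: field_simps)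
    also have "\<dots> \<le> K * (1 / 2 * (1 + \<tau> + W))"
      using K W0 \<tau>0 qC by (intro mult_left_mono mult_right_mono) auto
    finally have "U * (K * \<tau> - K * (1 / 2 * (1 + \<tau> + W)) - 4 * W) \<le> U * (K * \<tau> - K / (q * \<eta>) * D - 4 * W)"
      using U0 by (intro mult_left_mono) auto
    with main have "U * (K * \<tau> - K * (1 / 2 * (1 + \<tau> + W)) - 4 * W) \<le> A * (1 + W)" by linarith
    then have "K * U * \<tau> \<le> 2 * A * (1 + W) + 8 * U * W + K * U * (1 + W)"
      by (simp add: field_simps)
    also have "\<dots> \<le> 2 * M * (1 + W)"
      using U0 K W0 by (simp add: M_def field_simps)
    finally have "K * U / (2 * M) * \<tau> \<le> 1 + W" using M0 by (simp add: field_simps)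
    then show ?thesis by (simp add: \<tau>_def W_def q_def)
  qed
  then show thesis using that[of "K * U / (2 * M)" "max N1 (nat \<lceil>(2 * C / \<eta>)\<^sup>2\<rceil>)"] K U0 M0 by simp
qed

end

section \<open>Optimality gap\<close>

lemma bounded_family_convergent_subseq:
  fixes Y :: "nat \<Rightarrow> 'a::finite \<Rightarrow> real"
  assumes "\<And>n p. \<bar>Y n p\<bar> \<le> B"
  obtains Z \<rho> where "strict_mono \<rho>" "\<And>p. (\<lambda>n. Y (\<rho> n) p) \<longlonglongrightarrow> Z p"
proof -
  define x :: "nat \<Rightarrow> real^'a" where "x n = (\<chi> p. Y n p)" for n
  have "bounded (range x)"
  proof (rule boundedI)
    fix v assume "v \<in> range x"
    then obtain n where v: "v = x n" by blast
    have "norm v \<le> (\<Sum>p\<in>UNIV. \<bar>v $ p\<bar>)" by (rule norm_le_l1_cart)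
    also have "\<dots> \<le> (\<Sum>p\<in>(UNIV::'a set). B)" using assms by (intro sum_mono) (simp add: v x_def)
    finally show "norm v \<le> (\<Sum>p\<in>(UNIV::'a set). B)" .
  qed
  then obtain l \<rho> where "strict_mono \<rho>" and l: "(x \<circ> \<rho>) \<longlonglongrightarrow> l"
    using bounded_imp_convergent_subsequence by blast
  moreover have "(\<lambda>n. Y (\<rho> n) p) \<longlonglongrightarrow> l $ p" for p
    using tendsto_vec_nth[OF l, of p] by (simp add: x_def)
  ultimately show thesis using that by blast
qed

lemma R_rel_eq:
  assumes "lp_optimal P r \<alpha> y"
  shows "R_rel P r \<alpha> = lp_obj r y"
  unfolding R_rel_def using assms
  by (intro cSup_eq_maximum) (auto simp: lp_optimal_def)

context neutral_lp
begin

text \<open>Occupation measures averaged over a long horizon accumulate at feasible points of the LP, up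
  to the telescoping flow defect of order 1/T.\<close>

lemma reward_gap:
  assumes run: "run N J"
    and sharp: "k > 0" "\<And>z. lp_feasible P \<alpha> z \<Longrightarrow> k * off_mass y z \<le> lp_obj r y - lp_obj r z"
    and wrong: "\<And>T. b * real T \<le> 1 + (\<Sum>t<T. mean_wrong J t)"
    and lim: "(\<lambda>T. (\<Sum>t<T. expect (J t) (\<lambda>z. lp_obj r (sa_freq (fst z) (snd z)))) / real T) \<longlonglongrightarrow> L"
  shows "k * b \<le> lp_obj r y - L"
proof -
  define m where "m t s a = expect (J t) (\<lambda>z. sa_freq (fst z) (snd z) s a)" for t s a
  define Y where "Y T s a = (\<Sum>t<T. m t s a) / real T" for T s a
  have fin: "finite (set_pmf (J t))" for t by (rule run_finite[OF run])
  have E_sum: "expect (J t) (\<lambda>z. \<Sum>i\<in>I. f i z) = (\<Sum>i\<in>I. expect (J t) (f i))"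
    for t and I :: "'i set" and f :: "'i \<Rightarrow> _ \<Rightarrow> real"
    by (intro Bochner_Integration.integral_sum integrable_measure_pmf_finite fin)
  have m01: "0 \<le> m t s a \<and> m t s a \<le> 1" for t s a
    unfolding m_def by (intro expect_bounds fin) (simp add: sa_freq_nonneg sa_freq_le_1)
  have E_const: "expect (J t) f = d" if "\<And>z. z \<in> set_pmf (J t) \<Longrightarrow> f z = d" for t f and d :: real
    using expect_cong[of "J t" f "\<lambda>_. d"] that by simp
  have m_True: "(\<Sum>s\<in>UNIV. m t s True) = \<alpha>" for t
    unfolding m_def E_sum[symmetric] by (rule E_const) (rule budgeted_sum_True[OF runD(3)[OF run]])
  have len: "length (fst z) = length (snd z)" if "z \<in> set_pmf (J t)" for z t
    using runD(1,2)[OF run that] by simp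
  have marg: "(\<Sum>a\<in>UNIV. m t s a) = expect (J t) (\<lambda>z. X_of (fst z) s)" for t s
    unfolding m_def E_sum[symmetric] UNIV_bool
    by (intro expect_cong) (simp add: sa_freq_marginal len[of _ t])
  have m_sum: "(\<Sum>s\<in>UNIV. \<Sum>a\<in>UNIV. m t s a) = 1" for t
    unfolding marg E_sum[symmetric]
    by (rule E_const, rule sum_X_of) (use runD(3)[OF run] in \<open>auto simp: budgeted_def\<close>)
  have m_next: "(\<Sum>s'\<in>UNIV. \<Sum>a\<in>UNIV. m t s' a * pmf (P s' a) s) = (\<Sum>a\<in>UNIV. m (Suc t) s a)" for t s
  proof -
    have "(\<Sum>s'\<in>UNIV. \<Sum>a\<in>UNIV. m t s' a * pmf (P s' a) s)
        = expect (J t) (\<lambda>z. \<Sum>s'\<in>UNIV. \<Sum>a\<in>UNIV. sa_freq (fst z) (snd z) s' a * pmf (P s' a) s)"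
      by (simp only: E_sum m_def integral_mult_left_zero)
    also have "\<dots> = expect (J t) (\<lambda>z. expect (next_states P (fst z) (snd z)) (\<lambda>xs. X_of xs s))"
      by (intro expect_cong expect_X_of(1)[symmetric]) (use runD(3)[OF run] in \<open>auto simp: budgeted_def\<close>)
    also have "\<dots> = (\<Sum>a\<in>UNIV. m (Suc t) s a)"
      unfolding marg by (rule run_expect_Suc[OF run, symmetric])
    finally show ?thesis .
  qed
  have Y01: "0 \<le> Y T s a \<and> Y T s a \<le> 1" for T s a
  proof -
    have "(\<Sum>t<T. m t s a) \<le> (\<Sum>t<T. 1)" using m01 by (intro sum_mono) auto
    then show ?thesis using m01 by (auto simp: Y_def sum_nonneg divide_le_eq_1)
  qed
  \<comment> \<open>The shift by \<open>Suc\<close> avoids horizon 0, where the time average is a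
    division by zero.\<close>
  obtain \<rho> Z' where \<rho>: "strict_mono \<rho>" and "\<And>p. (\<lambda>n. Y (Suc (\<rho> n)) (fst p) (snd p)) \<longlonglongrightarrow> Z' p"
    using bounded_family_convergent_subseq[of "\<lambda>n p. Y (Suc n) (fst p) (snd p)" 1] Y01
    by (metis abs_of_nonneg)
  then have Z: "(\<lambda>n. Y (Suc (\<rho> n)) s a) \<longlonglongrightarrow> Z' (s, a)" for s a by (metis fst_conv snd_conv)
  define Z where "Z s a = Z' (s, a)" for s a
  note Z = Z[folded Z_def]
  have lin: "(\<lambda>n. \<Sum>s\<in>UNIV. \<Sum>a\<in>UNIV. Y (Suc (\<rho> n)) s a * g s a) \<longlonglongrightarrow> (\<Sum>s\<in>UNIV. \<Sum>a\<in>UNIV. Z s a * g s a)"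
    for g :: "'s \<Rightarrow> bool \<Rightarrow> real"
    by (intro tendsto_sum tendsto_mult_right Z)
  have Ylin: "(\<Sum>s\<in>UNIV. \<Sum>a\<in>UNIV. Y T s a * g s a) = (\<Sum>t<T. \<Sum>s\<in>UNIV. \<Sum>a\<in>UNIV. m t s a * g s a) / real T"
    for T and g :: "'s \<Rightarrow> bool \<Rightarrow> real"
    unfolding sum_UNIV_pair
    by (subst sum.swap) (simp add: Y_def sum_divide_distrib sum_distrib_right)
  \<comment> \<open>The constraints with equality and the objective are linear, so each is read off
    at \<open>Z\<close> by a weight \<open>g\<close> whose time averages converge.\<close>
  have uniq: "(\<Sum>s\<in>UNIV. \<Sum>a\<in>UNIV. Z s a * g s a) = d"
    if "(\<lambda>T. (\<Sum>t<T. \<Sum>s\<in>UNIV. \<Sum>a\<in>UNIV. m t s a * g s a) / real T) \<longlonglongrightarrow> d" for g d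
  proof (rule LIMSEQ_unique[OF lin])
    have "(\<lambda>n. (\<Sum>t<Suc (\<rho> n). \<Sum>s\<in>UNIV. \<Sum>a\<in>UNIV. m t s a * g s a) / real (Suc (\<rho> n))) \<longlonglongrightarrow> d"
      using LIMSEQ_subseq_LIMSEQ[OF LIMSEQ_Suc[OF that] \<rho>] by (simp add: o_def)
    then show "(\<lambda>n. \<Sum>s\<in>UNIV. \<Sum>a\<in>UNIV. Y (Suc (\<rho> n)) s a * g s a) \<longlonglongrightarrow> d"
      unfolding Ylin .
  qed
  have pick: "(\<Sum>s'\<in>UNIV. \<Sum>a\<in>UNIV. f s' a * of_bool (s' = s)) = (\<Sum>a\<in>UNIV. f s a)"
    for f :: "'s \<Rightarrow> bool \<Rightarrow> real" and s
    unfolding sum_distrib_right[symmetric]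
    by (subst sum.remove[of UNIV s]) (auto intro!: sum.neutral)
  have const: "(\<lambda>T. (\<Sum>t<T. d) / real T) \<longlonglongrightarrow> d" for d :: real
    by (rule tendsto_eventually, rule eventually_mono[OF eventually_gt_at_top[of 0]]) simp
  have feasZ: "lp_feasible P \<alpha> Z"
    unfolding lp_feasible_def
  proof (intro conjI allI)
    show "0 \<le> Z s a" for s a using Y01 by (intro LIMSEQ_le_const[OF Z]) auto
    have "(\<Sum>s\<in>UNIV. \<Sum>a\<in>UNIV. Z s a * of_bool a) = \<alpha>"
      by (rule uniq) (use const m_True in \<open>simp add: UNIV_bool\<close>)
    then show "(\<Sum>s\<in>UNIV. Z s True) = \<alpha>" by (simp add: UNIV_bool)
    have "(\<Sum>s\<in>UNIV. \<Sum>a\<in>UNIV. Z s a * 1) = 1"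
      by (rule uniq) (use const m_sum in simp)
    then show "(\<Sum>s\<in>UNIV. \<Sum>a\<in>UNIV. Z s a) = 1" by simp
    fix s
    \<comment> \<open>The weight measures inflow minus present mass. Over time it telescopes to a
      bounded difference, which division by T removes.\<close>
    have "(\<Sum>s'\<in>UNIV. \<Sum>a\<in>UNIV. Z s' a * (pmf (P s' a) s - of_bool (s' = s))) = 0"
    proof (rule uniq)
      define x where "x t = (\<Sum>a\<in>UNIV. m t s a)" for t
      have "(\<Sum>s'\<in>UNIV. \<Sum>a\<in>UNIV. m t s' a * (pmf (P s' a) s - of_bool (s' = s))) = x (Suc t) - x t" for t
      proof -
        have "(\<Sum>s'\<in>UNIV. \<Sum>a\<in>UNIV. m t s' a * of_bool (s' = s)) = x t"
          unfolding x_def by (rule pick)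
        then show ?thesis using m_next[of t s] by (simp add: x_def right_diff_distrib sum_subtractf)
      qed
      then have eq: "(\<Sum>t<T. \<Sum>s'\<in>UNIV. \<Sum>a\<in>UNIV. m t s' a * (pmf (P s' a) s - of_bool (s' = s))) = x T - x 0" for T
        by (simp add: sum_lessThan_telescope)
      have x01: "0 \<le> x t \<and> x t \<le> 1" for t unfolding x_def marg
        by (intro expect_bounds fin) (simp add: X_of_bounds)
      have "(\<lambda>T. (x T - x 0) / real T) \<longlonglongrightarrow> 0"
      proof (rule tendsto_rabs_zero_cancel, rule tendsto_sandwich[of "\<lambda>_. 0" _ _ "\<lambda>T. 1 / real T"])
        show "(\<lambda>T. 1 / real T) \<longlonglongrightarrow> 0" by (rule lim_1_over_n)
        show "\<forall>\<^sub>F T in sequentially. \<bar>(x T - x 0) / real T\<bar> \<le> 1 / real T"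
        proof (intro always_eventually allI)
          fix T
          have "\<bar>x T - x 0\<bar> \<le> 1" using x01[of T] x01[of 0] by linarith
          then show "\<bar>(x T - x 0) / real T\<bar> \<le> 1 / real T" by (simp add: divide_right_mono)
        qed
      qed auto
      then show "(\<lambda>T. (\<Sum>t<T. \<Sum>s'\<in>UNIV. \<Sum>a\<in>UNIV. m t s' a * (pmf (P s' a) s - of_bool (s' = s))) / real T) \<longlonglongrightarrow> 0"
        unfolding eq .
    qed
    then show "(\<Sum>s'\<in>UNIV. \<Sum>a\<in>UNIV. Z s' a * pmf (P s' a) s) = (\<Sum>a\<in>UNIV. Z s a)"
      by (simp only: right_diff_distrib sum_subtractf pick right_minus_eq)
  qed
  have objL: "lp_obj r Z = L"
  proof -
    have "(\<Sum>s\<in>UNIV. \<Sum>a\<in>UNIV. Z s a * r s a) = L"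
    proof (rule uniq)
      have "(\<Sum>s\<in>UNIV. \<Sum>a\<in>UNIV. m t s a * r s a) = expect (J t) (\<lambda>z. lp_obj r (sa_freq (fst z) (snd z)))" for t
        by (simp only: lp_obj_def E_sum m_def integral_mult_right_zero mult.commute[of _ "r _ _"])
      then show "(\<lambda>T. (\<Sum>t<T. \<Sum>s\<in>UNIV. \<Sum>a\<in>UNIV. m t s a * r s a) / real T) \<longlonglongrightarrow> L"
        using lim by simp
    qed
    then show ?thesis by (simp add: lp_obj_def mult.commute)
  qed
  \<comment> \<open>For the wrong mass only a lower bound is given, so the inequality itself passes
    to the limit along the subsequence; its additive 1 has become 1 / T.\<close>
  have "b \<le> off_mass y Z"
  proof -
    define g where "g s a = (of_bool (y s a = 0) :: real)" for s a
    have off: "off_mass y z = (\<Sum>s\<in>UNIV. \<Sum>a\<in>UNIV. z s a * g s a)" for z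
      by (simp add: off_mass_def g_def of_bool_def if_distrib cong: if_cong)
    have mw: "mean_wrong J t = (\<Sum>s\<in>UNIV. \<Sum>a\<in>UNIV. m t s a * g s a)" for t
      unfolding off by (simp only: E_sum m_def integral_mult_left_zero)
    have "(\<lambda>n. inverse (real (Suc (\<rho> n))) + (\<Sum>s\<in>UNIV. \<Sum>a\<in>UNIV. Y (Suc (\<rho> n)) s a * g s a)) \<longlonglongrightarrow> 0 + off_mass y Z"
      unfolding off using LIMSEQ_subseq_LIMSEQ[OF LIMSEQ_inverse_real_of_nat \<rho>]
      by (intro tendsto_add lin) (simp add: o_def)
    moreover have "b \<le> inverse (real (Suc (\<rho> n))) + (\<Sum>s\<in>UNIV. \<Sum>a\<in>UNIV. Y (Suc (\<rho> n)) s a * g s a)" for n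
      unfolding Ylin mw[symmetric] using wrong[of "Suc (\<rho> n)"]
      by (simp add: field_simps)
    ultimately have "b \<le> 0 + off_mass y Z" by (intro LIMSEQ_le_const) auto
    then show ?thesis by simp
  qed
  then have "k * b \<le> k * off_mass y Z" using sharp(1) by simp
  with sharp(2)[OF feasZ] objL show ?thesis by linarith
qed

section \<open>From policies to runs\<close>

definition policy_run :: "'s policy \<Rightarrow> 's list \<Rightarrow> nat \<Rightarrow> ('s list \<times> bool list) pmf" where
  "policy_run pol S0 t = bind_pmf (hist_pmf P pol S0 t) (\<lambda>(h, s). map_pmf (Pair s) (pol h s))"

lemma hist_pmf_support:
  assumes adm: "admissible_policy N \<alpha> pol" and "length S0 = N"
  shows "(\<forall>z\<in>set_pmf (hist_pmf P pol S0 t). length (snd z) = N) \<and> finite (set_pmf (hist_pmf P pol S0 t))"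
proof (induction t)
  case (Suc t)
  have len: "length s = length a" if "(h, s) \<in> set_pmf (hist_pmf P pol S0 t)" "a \<in> set_pmf (pol h s)" for h s a
    using Suc adm that by (force simp: admissible_policy_def)
  have fp: "finite (set_pmf (pol h s))" if "(h, s) \<in> set_pmf (hist_pmf P pol S0 t)" for h s
  proof (rule finite_subset)
    show "set_pmf (pol h s) \<subseteq> {as. length as = length s}" using len[OF that] by force
    show "finite {as :: bool list. length as = length s}"
      using finite_lists_length_eq[of "UNIV :: bool set"] by simp
  qed
  have "length (snd z) = N" if z: "z \<in> set_pmf (hist_pmf P pol S0 (Suc t))" for z
  proof -
    from z obtain h s a s' where z: "(h, s) \<in> set_pmf (hist_pmf P pol S0 t)" "a \<in> set_pmf (pol h s)"
      "s' \<in> set_pmf (next_states P s a)" "z = (h @ [(s, a)], s')" by auto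
    then have "length s' = length s" using next_states_support[of s a P] len[OF z(1,2)] by auto
    moreover have "length s = N" using Suc z(1) by force
    ultimately show ?thesis using z(4) by simp
  qed
  moreover have "finite (set_pmf (hist_pmf P pol S0 (Suc t)))"
    using Suc fp len by (auto intro!: finite_imageI next_states_finite)
  ultimately show ?case by blast
qed (use assms in simp)

text \<open>The next state depends on the history only through the current pair, so integrating out
  the history leaves a run. A step's reward is linear in the empirical frequencies and is the LP
  objective evaluated at them.\<close>

lemma policy_run:
  assumes adm: "admissible_policy N \<alpha> pol" and S0: "length S0 = N" and N: "N > 0"
  shows "run N (policy_run pol S0)"
    and "exp_reward P r pol S0 t = expect (policy_run pol S0 t) (\<lambda>z. lp_obj r (sa_freq (fst z) (snd z)))"
proof -
  note H = hist_pmf_support[OF adm S0]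
  have supp: "length (fst z) = N \<and> length (snd z) = N \<and> budgeted (fst z) (snd z)"
    if z: "z \<in> set_pmf (policy_run pol S0 t)" for z t
  proof -
    from z obtain h s a where z: "(h, s) \<in> set_pmf (hist_pmf P pol S0 t)" "a \<in> set_pmf (pol h s)" "z = (s, a)"
      by (auto simp: policy_run_def)
    then have "length s = N" using H[of t] by force
    with adm z(2) have "length a = N \<and> real (card {i. i < N \<and> a ! i}) = \<alpha> * real N"
      by (auto simp: admissible_policy_def)
    with \<open>length s = N\<close> N z(3) show ?thesis by (auto simp: budgeted_def)
  qed
  have state: "map_pmf fst (policy_run pol S0 t) = map_pmf snd (hist_pmf P pol S0 t)" for t
    by (simp add: policy_run_def map_bind_pmf map_pmf_comp case_prod_beta map_pmf_const map_pmf_def[of snd])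
  have "map_pmf fst (policy_run pol S0 (Suc t))
      = bind_pmf (policy_run pol S0 t) (\<lambda>z. next_states P (fst z) (snd z))" for t
    unfolding state
    by (simp add: policy_run_def map_bind_pmf bind_assoc_pmf bind_map_pmf map_pmf_comp case_prod_beta)
  then show "run N (policy_run pol S0)"
    using supp by (simp add: run_def)
  have fp: "finite (set_pmf (pol h s))" if "(h, s) \<in> set_pmf (hist_pmf P pol S0 t)" for h s
  proof -
    have "Pair s ` set_pmf (pol h s) \<subseteq> set_pmf (policy_run pol S0 t)"
      using that by (force simp: policy_run_def)
    then have "finite (Pair s ` set_pmf (pol h s))"
      using run_finite[OF \<open>run N (policy_run pol S0)\<close>] finite_subset by blast
    then show ?thesis by (rule finite_imageD) (simp add: inj_on_def)
  qed
  have "expect (policy_run pol S0 t) (\<lambda>z. lp_obj r (sa_freq (fst z) (snd z)))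
     = expect (hist_pmf P pol S0 t) (\<lambda>(h, s). expect (pol h s) (\<lambda>a. lp_obj r (sa_freq s a)))"
    unfolding policy_run_def using H[of t] fp
    by (subst expect_bind) (auto simp: case_prod_beta')
  also have "\<dots> = exp_reward P r pol S0 t"
    unfolding exp_reward_def
  proof (intro expect_cong, clarify)
    fix h s assume hs: "(h, s) \<in> set_pmf (hist_pmf P pol S0 t)"
    show "expect (pol h s) (\<lambda>a. lp_obj r (sa_freq s a))
        = expect (pol h s) (\<lambda>a. (\<Sum>i<length s. r (s ! i) (a ! i)) / real (length s))"
    proof (rule expect_cong)
      fix a assume a: "a \<in> set_pmf (pol h s)"
      then have "(s, a) \<in> set_pmf (policy_run pol S0 t)" using hs by (force simp: policy_run_def)
      from supp[OF this] have len: "length s = length a" by simp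
      have "lp_obj r (sa_freq s a) = (\<Sum>(s, a)\<leftarrow>zip s a. r s a) / real (length s)"
        using sum_sa_freq[of s a r] by (simp add: lp_obj_def mult.commute)
      also have "(\<Sum>(s, a)\<leftarrow>zip s a. r s a) = (\<Sum>i<length s. r (s ! i) (a ! i))"
        using len by (simp add: sum_list_sum_nth atLeast0LessThan)
      finally show "lp_obj r (sa_freq s a) = (\<Sum>i<length s. r (s ! i) (a ! i)) / real (length s)" .
    qed
  qed
  finally show "exp_reward P r pol S0 t = expect (policy_run pol S0 t) (\<lambda>z. lp_obj r (sa_freq (fst z) (snd z)))" ..
qed

end

theorem theorem2:
  fixes P :: "'s::finite \<Rightarrow> bool \<Rightarrow> 's pmf"
    and r :: "'s \<Rightarrow> bool \<Rightarrow> real"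
    and \<alpha> :: real
  assumes "0 < \<alpha>" and "\<alpha> < 1"
    and "regular_unstable_RB P r \<alpha>"
  shows "\<exists>c > 0. \<exists>N0. \<forall>N \<ge> N0. \<alpha> * real N \<in> \<int> \<longrightarrow>
           (\<forall>(pol :: 's policy) S0. admissible_policy N \<alpha> pol \<longrightarrow> length S0 = N \<longrightarrow>
              reward_well_defined P r pol S0 \<longrightarrow>
              R_rel P r \<alpha> - long_run_reward P r pol S0 \<ge> c / sqrt (real N))"
proof -
  define y where "y = ystar P r \<alpha>"
  define st where "st = (THE st. y st False > 0 \<and> y st True > 0)"
  note R = assms(3)[unfolded regular_unstable_RB_def Let_def, folded y_def, folded st_def]
  note ex1 = R[THEN conjunct1]
    and full = R[THEN conjunct2, THEN conjunct1]
    and st1 = R[THEN conjunct2, THEN conjunct2, THEN conjunct2, THEN conjunct2, THEN conjunct1]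
    and R' = R[THEN conjunct2, THEN conjunct2, THEN conjunct2, THEN conjunct2, THEN conjunct2]
  have opt: "lp_optimal P r \<alpha> y" unfolding y_def ystar_def by (rule theI'[OF ex1])
  have uniq: "z = y" if "lp_optimal P r \<alpha> z" for z using ex1 opt that by blast
  have st: "y st False > 0 \<and> y st True > 0" unfolding st_def by (rule theI'[OF st1])
  interpret neutral_lp P \<alpha> y st
  proof
    show "lp_feasible P \<alpha> y" using opt by (simp add: lp_optimal_def)
    show "s = st" if "y s False > 0" "y s True > 0" for s using st1 st that by blast
  qed (use full st in simp_all)
  obtain l where l: "eigenvalue \<Phi> l" "cmod l > 1" using R'[THEN conjunct1] by blast
  have hyp: "cmod z \<noteq> 1" if "eigenvalue \<Phi> z" for z
    using R'[THEN conjunct2, THEN conjunct1] that by blast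
  obtain \<eta> K N1 where \<eta>: "\<eta> > 0" and K: "K > 0" and noise: "\<forall>N \<ge> N1. \<forall>ss. length ss = N \<longrightarrow>
      (\<Sum>s\<in>UNIV. \<bar>X_of ss s - \<mu> s\<bar>) \<le> \<eta> \<longrightarrow> olc_defined \<alpha> y st ss \<and>
        (\<forall>a \<in> set_pmf (olc_pmf \<alpha> y st ss). \<forall>\<xi>::'s \<Rightarrow> real.
          sqrt (\<Sum>s\<in>UNIV. (\<xi> s)\<^sup>2) = 1 \<longrightarrow> (\<Sum>s\<in>UNIV. \<mu> s * \<xi> s) = 0 \<longrightarrow>
          measure_pmf.expectation (next_states P ss a) (\<lambda>ss'.
            \<bar>\<Sum>s\<in>UNIV. (X_of ss' s - \<mu> s - (\<Sum>s0\<in>UNIV. (X_of ss s0 - \<mu> s0) * \<Phi> s0 s)) * \<xi> s\<bar>)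
          \<ge> K / sqrt (real N))"
    using R'[THEN conjunct2, THEN conjunct2] by (elim exE conjE) (rule that)
  have noise': "olc_defined \<alpha> y st ss \<and> (\<forall>as\<in>set_pmf (olc_pmf \<alpha> y st ss).
      sqrt (\<Sum>s\<in>UNIV. (\<xi> s)\<^sup>2) = 1 \<longrightarrow> (\<Sum>s\<in>UNIV. \<mu> s * \<xi> s) = 0 \<longrightarrow>
      K / sqrt (real (length ss)) \<le> expect (next_states P ss as) (\<lambda>xs. \<bar>\<Sum>t\<in>UNIV. step_dev ss xs t * \<xi> t\<bar>))"
    if "length ss \<ge> N1" "l1_dist ss \<le> \<eta>" for ss and \<xi> :: "'s \<Rightarrow> real"
  proof -
    note n = noise[THEN spec, THEN mp, OF that(1), THEN spec, THEN mp, OF refl, THEN mp, OF that(2)[unfolded l1_dist_def]]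
    show ?thesis
      unfolding step_dev_def
    proof (intro conjI ballI)
      show "olc_defined \<alpha> y st ss" by (rule n[THEN conjunct1])
    qed (rule n[THEN conjunct2, THEN bspec, THEN spec])
  qed
  obtain c N0 where c: "c > 0" "\<And>N J T. N \<ge> N0 \<Longrightarrow> \<alpha> * real N \<in> \<int> \<Longrightarrow> run N J \<Longrightarrow>
     c * (real T / sqrt (real N)) \<le> 1 + (\<Sum>t<T. mean_wrong J t)"
  proof (rule mean_wrong_lower_bound[OF l hyp \<eta> K noise'])
    fix c N0 assume "c > 0" "\<And>N J T. N \<ge> N0 \<Longrightarrow> \<alpha> * real N \<in> \<int> \<Longrightarrow> run N J \<Longrightarrow>
     c * (real T / sqrt (real N)) \<le> 1 + (\<Sum>t<T. mean_wrong J t)"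
    then show thesis by (rule that)
  qed
  obtain k where k: "k > 0" "\<And>z. lp_feasible P \<alpha> z \<Longrightarrow> k * off_mass y z \<le> lp_obj r y - lp_obj r z"
    using lp_unique_optimum_sharp[OF opt uniq] by blast
  \<comment> \<open>The constant is the sharpness \<open>k\<close> times the rate \<open>c\<close>
    of wrong actions. N = 0 is excluded because a run has at least one arm.\<close>
  have "k * c / sqrt (real N) \<le> R_rel P r \<alpha> - long_run_reward P r pol S0"
    if N: "N \<ge> max N0 1" "\<alpha> * real N \<in> \<int>" and adm: "admissible_policy N \<alpha> pol" "length S0 = N"
      and wd: "reward_well_defined P r pol S0" for N S0 and pol :: "'s policy"
  proof -
    have N0: "N > 0" using N by simp
    note run = policy_run(1)[OF adm N0]
    have "avg_reward_seq P r pol S0 \<longlonglongrightarrow> long_run_reward P r pol S0"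
      using wd by (simp add: reward_well_defined_def long_run_reward_def convergent_LIMSEQ_iff)
    then have "(\<lambda>T. (\<Sum>t<T. expect (policy_run pol S0 t) (\<lambda>z. lp_obj r (sa_freq (fst z) (snd z)))) / real T)
        \<longlonglongrightarrow> long_run_reward P r pol S0"
      unfolding avg_reward_seq_def[abs_def] policy_run(2)[OF adm N0] .
    from reward_gap[OF run k _ this, of "c / sqrt (real N)"] c(2)[OF _ N(2) run] N(1)
    show ?thesis by (simp add: R_rel_eq[OF opt])
  qed
  then show ?thesis using k(1) c(1) by (intro exI[of _ "k * c"] exI[of _ "max N0 1"] conjI) simp_all
qed

end
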